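(* (a) For every integer $d>1$ there exist two vector fields $X$ and $Y$ on $\mathbb{R}^d$ with the following property: for every $n\geq 1$ and all points $x_1,\dots,x_n,y_1,\dots,y_n\in\mathbb{R}^d$ with $x_{i_1}\neq x_{i_2}$ and $y_{i_1}\neq y_{i_2}$ whenever $i_1\neq i_2$, there exists a finite collection of numbers $s_1,\dots,s_l,t_1,\dots,t_l\in\mathbb{R}$ such that $$e^{s_1X}\circ e^{t_1Y}\circ e^{s_2X}\circ e^{t_2Y}\circ\cdots\circ e^{s_lX}\circ e^{t_lY}(x_i)=y_i\qquad\text{for all } i=1,\dots,n.$$ Moreover, $X$ and $Y$ can be chosen so that $X$ is a constant vector field and $Y$ is a homogeneous cubic polynomial vector field. (b) For $d=1$, the same result holds (there exist vector fields $X,Y$ on $\mathbb{R}$, which can be chosen with $X$ constant and $Y$ a homogeneous cubic polynomial vector field, having the property above for every $n\ge 1$) provided that $x_1,\dots,x_n$ (pairwise distinct) and $y_1,\dots,y_n$ (pairwise distinct) have the same relative order, i.e. $x_{i_1}<x_{i_2}$ if and only if $y_{i_1}<y_{i_2}$ for all $i_1,i_2$.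
   Context: Vector fields are smooth. For a vector field $X$ on $\mathbb{R}^d$, $e^{tX}$ denotes its (local) flow: $\varphi_t(q)=e^{tX}(q)$ solves $\frac{d}{dt}\varphi_t(q)=X(\varphi_t(q))$, $\varphi_0(q)=q$. Flows need not be complete; the asserted identity includes the statement that each successive local flow in the composition is defined at the points to which it is applied. The fields $X,Y$ depend only on $d$, not on $n$ or on the points. A homogeneous cubic polynomial vector field is one whose components in the standard coordinates are homogeneous polynomials of degree $3$; a constant vector field has constant components. *)

theory Defs
  imports "HOL-Analysis.Analysis"
begin

text \<open>Smoothness means that all iterated directional derivatives exist and are continuous.\<close>

primrec C_k :: "nat \<Rightarrow> ('a::euclidean_space \<Rightarrow> 'b::real_normed_vector) \<Rightarrow> bool" where
  "C_k 0 f \<longleftrightarrow> continuous_on UNIV f"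
| "C_k (Suc k) f \<longleftrightarrow> f differentiable_on UNIV \<and> (\<forall>v. C_k k (\<lambda>x. frechet_derivative f (at x) v))"

definition smooth :: "('a::euclidean_space \<Rightarrow> 'b::real_normed_vector) \<Rightarrow> bool" where
  "smooth f \<longleftrightarrow> (\<forall>k. C_k k f)"

text \<open>In the components along \<^const>\<open>Basis\<close>, which is the standard basis for \<^typ>\<open>real ^ 'd\<close> and
  \<open>{1}\<close> for \<^typ>\<open>real\<close>. The sum runs over the multi-indices of total degree \<open>k\<close>; the bound
  \<open>\<alpha> e \<le> k\<close> is automatic for them and only makes the finiteness of the index set evident.\<close>

definition homogeneous_polynomial_field :: "nat \<Rightarrow> ('a::euclidean_space \<Rightarrow> 'a) \<Rightarrow> bool" where
  "homogeneous_polynomial_field k Y \<longleftrightarrow>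
     (\<forall>b\<in>Basis. \<exists>c :: ('a \<Rightarrow> nat) \<Rightarrow> real. \<forall>x.
        Y x \<bullet> b = (\<Sum>\<alpha> | \<alpha> \<in> Basis \<rightarrow>\<^sub>E {..k} \<and> sum \<alpha> Basis = k. c \<alpha> * (\<Prod>e\<in>Basis. (x \<bullet> e) ^ \<alpha> e)))"

definition flows_to :: "('a::real_normed_vector \<Rightarrow> 'a) \<Rightarrow> real \<Rightarrow> 'a \<Rightarrow> 'a \<Rightarrow> bool" where
  "flows_to X t q p \<longleftrightarrow>
     (\<exists>I \<phi>. open I \<and> is_interval I \<and> 0 \<in> I \<and> t \<in> I \<and>
        (\<forall>s\<in>I. (\<phi> has_vector_derivative X (\<phi> s)) (at s)) \<and> \<phi> 0 = q \<and> \<phi> t = p)"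

text \<open>The local flow \<open>e^{tX}\<close> as a partial map: it is \<^const>\<open>None\<close> exactly where no integral curve
  from \<open>q\<close> lives until time \<open>t\<close>. For smooth \<open>X\<close> the endpoint is unique, see
  \<open>flow_eq_Some_iff\<close> below.\<close>

definition flow :: "('a::real_normed_vector \<Rightarrow> 'a) \<Rightarrow> real \<Rightarrow> 'a \<rightharpoonup> 'a" where
  "flow X t q = (if \<exists>p. flows_to X t q p then Some (THE p. flows_to X t q p) else None)"

text \<open>For \<open>[(s\<^sub>1, t\<^sub>1), \<dots>, (s\<^sub>l, t\<^sub>l)]\<close> this is
  \<open>e^{s\<^sub>1 X} \<circ> e^{t\<^sub>1 Y} \<circ> \<dots> \<circ> e^{s\<^sub>l X} \<circ> e^{t\<^sub>l Y}\<close> (the last pair acts first),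
  defined only where every successive local flow is.\<close>

definition flow_composition ::
    "('a::real_normed_vector \<Rightarrow> 'a) \<Rightarrow> ('a \<Rightarrow> 'a) \<Rightarrow> (real \<times> real) list \<Rightarrow> 'a \<rightharpoonup> 'a" where
  "flow_composition X Y sts = foldr (\<lambda>(s, t) F. flow X s \<circ>\<^sub>m flow Y t \<circ>\<^sub>m F) sts Some"


lemma smooth_lipschitz_on_cball:
  fixes f :: "'a::euclidean_space \<Rightarrow> 'b::real_normed_vector"
  assumes "smooth f"
  obtains L where "0 \<le> L"
    "\<And>x y. x \<in> cball 0 r \<Longrightarrow> y \<in> cball 0 r \<Longrightarrow> norm (f x - f y) \<le> L * norm (x - y)"
proof -
  let ?D = "\<lambda>x. frechet_derivative f (at x)"
  have "C_k (Suc 0) f" using assms unfolding smooth_def by blast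
  then have diff: "f differentiable_on UNIV" and cont: "\<And>v. continuous_on UNIV (\<lambda>x. ?D x v)"
    by auto
  have der: "(f has_derivative ?D x) (at x)" for x
    using diff by (simp add: differentiable_on_def frechet_derivative_works)
  have "continuous_on (cball 0 r) (\<lambda>x. \<Sum>b\<in>Basis. norm (?D x b))"
    by (intro continuous_intros continuous_on_subset[OF cont]) auto
  then have "compact ((\<lambda>x. \<Sum>b\<in>Basis. norm (?D x b)) ` cball 0 r)"
    by (intro compact_continuous_image) auto
  then have "bounded ((\<lambda>x. \<Sum>b\<in>Basis. norm (?D x b)) ` cball 0 r)"
    by (rule compact_imp_bounded)
  then obtain B where B: "B > 0" "\<And>x. x \<in> cball 0 r \<Longrightarrow> (\<Sum>b\<in>Basis. norm (?D x b)) \<le> B"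
    unfolding bounded_pos by (fastforce dest: abs_le_D1)
  have on: "onorm (?D x) \<le> B" if "x \<in> cball 0 r" for x
  proof (rule onorm_le)
    fix v
    interpret bounded_linear "?D x" using der has_derivative_bounded_linear by blast
    have "?D x v = (\<Sum>b\<in>Basis. (v \<bullet> b) *\<^sub>R ?D x b)"
      by (subst euclidean_representation[of v, symmetric]) (simp add: sum scale)
    also have "norm \<dots> \<le> (\<Sum>b\<in>Basis. norm v * norm (?D x b))"
      by (intro order.trans[OF norm_sum] sum_mono) (simp add: Basis_le_norm mult_right_mono)
    also have "\<dots> = (\<Sum>b\<in>Basis. norm (?D x b)) * norm v"
      by (simp add: sum_distrib_left mult.commute)
    also have "\<dots> \<le> B * norm v" using B(2)[OF that] by (intro mult_right_mono) auto
    finally show "norm (?D x v) \<le> B * norm v" .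
  qed
  have "norm (f x - f y) \<le> B * norm (x - y)" if "x \<in> cball 0 r" "y \<in> cball 0 r" for x y
    by (rule differentiable_bound[where S = "cball 0 r", OF convex_cball
          has_derivative_at_withinI[OF der] on]) (use that in auto)
  then show thesis using B(1) by (intro that[of B]) auto
qed

lemma integral_curves_agree:
  fixes X :: "'a::euclidean_space \<Rightarrow> 'a"
  assumes "smooth X" and "0 \<le> t"
    and \<phi>: "\<And>s. s \<in> {0..t} \<Longrightarrow> (\<phi> has_vector_derivative c *\<^sub>R X (\<phi> s)) (at s)"
    and \<psi>: "\<And>s. s \<in> {0..t} \<Longrightarrow> (\<psi> has_vector_derivative c *\<^sub>R X (\<psi> s)) (at s)"
    and "\<phi> 0 = \<psi> 0"
  shows "\<phi> t = \<psi> t"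
proof -
  have "continuous_on {0..t} \<phi>" "continuous_on {0..t} \<psi>"
    using \<phi> \<psi> by (meson has_vector_derivative_continuous continuous_at_imp_continuous_on)+
  then have "bounded (\<phi> ` {0..t} \<union> \<psi> ` {0..t})"
    by (intro bounded_Un[THEN iffD2] conjI compact_imp_bounded compact_continuous_image) auto
  then obtain r where "\<forall>z\<in>\<phi> ` {0..t} \<union> \<psi> ` {0..t}. norm z \<le> r"
    unfolding bounded_iff by blast
  then have r: "\<And>s. s \<in> {0..t} \<Longrightarrow> \<phi> s \<in> cball 0 r \<and> \<psi> s \<in> cball 0 r"
    by auto
  obtain L where L: "0 \<le> L"
    "\<And>x y. x \<in> cball 0 r \<Longrightarrow> y \<in> cball 0 r \<Longrightarrow> norm (X x - X y) \<le> L * norm (x - y)"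
    using smooth_lipschitz_on_cball[OF assms(1)] by metis
  define K where "K = \<bar>c\<bar> * L"
  define u where "u s = \<phi> s - \<psi> s" for s
  define w where "w s = exp (- 2 * K * s) * (u s \<bullet> u s)" for s
  have "w t \<le> w 0"
  proof (rule DERIV_nonpos_imp_nonincreasing[OF assms(2)])
    fix s assume s: "0 \<le> s" "s \<le> t"
    let ?u' = "c *\<^sub>R (X (\<phi> s) - X (\<psi> s))"
    have u': "(u has_vector_derivative ?u') (at s)"
      unfolding u_def scaleR_diff_right
      by (rule has_vector_derivative_diff) (use \<phi> \<psi> s in auto)
    have "((\<lambda>s. u s \<bullet> u s) has_real_derivative 2 * (u s \<bullet> ?u')) (at s)"
      unfolding has_field_derivative_def
      by (rule has_derivative_eq_rhs[OF has_derivative_inner[OF u'[unfolded has_vector_derivative_def]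
            u'[unfolded has_vector_derivative_def]]]) (auto simp: inner_commute algebra_simps)
    then have "(w has_real_derivative
        exp (- 2 * K * s) * (2 * (u s \<bullet> ?u')) + exp (- 2 * K * s) * (- 2 * K) * (u s \<bullet> u s)) (at s)"
      unfolding w_def by (auto intro!: derivative_eq_intros)
    moreover have "u s \<bullet> ?u' \<le> K * (u s \<bullet> u s)"
    proof -
      have "u s \<bullet> ?u' \<le> norm (u s) * norm ?u'" by (rule norm_cauchy_schwarz)
      also have "\<dots> \<le> norm (u s) * (\<bar>c\<bar> * (L * norm (u s)))"
        using L(2) r s unfolding u_def by (auto intro!: mult_left_mono)
      also have "\<dots> = K * (u s \<bullet> u s)"
        by (simp add: K_def power2_norm_eq_inner[symmetric] power2_eq_square)
      finally show ?thesis .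
    qed
    then have "exp (- 2 * K * s) * (2 * (u s \<bullet> ?u')) + exp (- 2 * K * s) * (- 2 * K) * (u s \<bullet> u s) \<le> 0"
      by (simp add: mult.assoc flip: distrib_left)
    ultimately show "\<exists>y. (w has_real_derivative y) (at s) \<and> y \<le> 0" by blast
  qed
  moreover have "w 0 = 0" using assms(5) by (simp add: w_def u_def)
  ultimately have "u t \<bullet> u t \<le> 0" unfolding w_def by (simp add: mult_le_0_iff)
  then show ?thesis using inner_gt_zero_iff[of "u t"] by (auto simp: u_def simp del: inner_gt_zero_iff)
qed

lemma flows_to_unique:
  fixes X :: "'a::euclidean_space \<Rightarrow> 'a"
  assumes "smooth X" "flows_to X t q p" "flows_to X t q p'"
  shows "p = p'"
proof -
  obtain I \<phi> where I: "is_interval I" "0 \<in> I" "t \<in> I"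
    "\<And>s. s \<in> I \<Longrightarrow> (\<phi> has_vector_derivative X (\<phi> s)) (at s)" "\<phi> 0 = q" "\<phi> t = p"
    using assms(2) unfolding flows_to_def by blast
  obtain J \<psi> where J: "is_interval J" "0 \<in> J" "t \<in> J"
    "\<And>s. s \<in> J \<Longrightarrow> (\<psi> has_vector_derivative X (\<psi> s)) (at s)" "\<psi> 0 = q" "\<psi> t = p'"
    using assms(3) unfolding flows_to_def by blast
  have mem: "s * t \<in> I \<and> s * t \<in> J" if "s \<in> {0..1}" for s
  proof -
    have "s * t \<in> closed_segment 0 t" using that by (auto simp: closed_segment_def)
    then show ?thesis using I(1-3) J(1-3) by (metis closed_segment_subset is_interval_convex subsetD)
  qed
  have scale: "((\<lambda>s. \<xi> (s * t)) has_vector_derivative t *\<^sub>R X (\<xi> (s * t))) (at s)"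
    if "(\<xi> has_vector_derivative X (\<xi> (s * t))) (at (s * t))" for \<xi> s
  proof -
    have "((\<lambda>s. s * t) has_vector_derivative t) (at s)"
      by (auto simp flip: has_real_derivative_iff_has_vector_derivative
            intro!: derivative_eq_intros)
    from vector_diff_chain_at[OF this that] show ?thesis by (simp add: o_def)
  qed
  have "\<phi> (1 * t) = \<psi> (1 * t)"
    by (rule integral_curves_agree[OF assms(1), where t = 1 and \<phi> = "\<lambda>s. \<phi> (s * t)"
          and \<psi> = "\<lambda>s. \<psi> (s * t)" and c = t])
       (use mem I J scale in auto)
  then show ?thesis using I J by simp
qed

lemma flow_eq_Some_iff:
  fixes X :: "'a::euclidean_space \<Rightarrow> 'a"
  assumes "smooth X"
  shows "flow X t q = Some p \<longleftrightarrow> flows_to X t q p"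
  using flows_to_unique[OF assms, of t q] unfolding flow_def
  by (auto intro: the_equality theI2)

end

theory Submission
  imports Defs "HOL-Complex_Analysis.Complex_Analysis"
begin

text \<open>Take \<open>X = (1, \<dots>, 1)\<close> and \<open>Y x = q(x) A x\<close> with \<open>q\<close> a nondegenerate quadratic form and \<open>A\<close>
  diagonal with distinct eigenvalues in \<open>(0, 1)\<close>, matched so that \<open>q\<close> satisfies \<open>q' = q\<^sup>2\<close> along \<open>Y\<close>.
  Then \<open>Y\<close> is a time change of a linear flow and \<open>e\<^bsup>tY\<^esup>\<close> is explicit, with powers of \<open>1 - t q(x)\<close>.

  Finitely many distinct points can be moved to points where \<open>q\<close> takes distinct positive values.
  There the pullbacks of \<open>X\<close> by \<open>e\<^bsup>tY\<^esup>\<close> span all tuples of tangent vectors: a covector annihilating them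
  gives a linear relation between powers of the functions \<open>1 - q(x\<^sub>i) t\<close>, and the relation has to be
  trivial because the singularities \<open>t = 1 / q(x\<^sub>i)\<close> are distinct. By Newton's method the orbit of a
  tuple of distinct points is therefore a neighbourhood of it, and orbits contain the connected sets
  of such tuples.\<close>

text \<open>A point with \<open>q x > 0\<close> has the singular time \<open>1 / q x\<close>, and
  these times are the labels that tell the points of a tuple apart; this is why general position
  means positive, pairwise distinct values of \<open>q\<close>. The exponents lie strictly between 0
  and 1 so that singular powers cannot be confused with the integer powers contributed by the other
  points, and they are distinct so that coordinates do not mix. No Lie brackets occur: pullbacks at
  finitely many times already span. The price is that the flow of \<open>Y\<close> is only local, so
  the condition \<open>t * q x < 1\<close> accompanies every move. As the number of points is
  arbitrary, a tuple is a function on \<open>nat\<close> of which only a finite index set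
  \<open>I\<close> matters, and the Newton argument runs in a Banach space of bounded functions.
  Dimension enters only in the last section. Above dimension one, any two tuples can be joined
  through points on a common generic line; on the real line, straight segments between tuples of the
  same order avoid collisions.\<close>

section \<open>Independence of powers of affine functions\<close>

text \<open>Divide by the lowest power that has a nonzero coefficient: the sum then tends to that
  coefficient, the bound to 0. Asking for the bound only frequently lets the contrapositive yield
  statements that hold eventually.\<close>

lemma powr_sum_dominated_imp_zero:
  fixes c e :: "'j \<Rightarrow> real"
  assumes "finite J" "inj_on e J" and K: "\<And>j. j \<in> J \<Longrightarrow> e j < K"
    and freq: "\<exists>\<^sub>F s in at_right 0. \<bar>\<Sum>j\<in>J. c j * s powr e j\<bar> \<le> C * s powr K"
    and "j \<in> J"
  shows "c j = 0"
proof (rule ccontr)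
  assume "c j \<noteq> 0"
  define J' where "J' = {j \<in> J. c j \<noteq> 0}"
  have J': "finite J'" "J' \<noteq> {}" using assms \<open>c j \<noteq> 0\<close> by (auto simp: J'_def)
  obtain m where m: "m \<in> J'" "\<And>k. k \<in> J' \<Longrightarrow> e m \<le> e k"
    using ex_min_if_finite[of "e ` J'"] J' by (metis (no_types, lifting) arg_min_if_finite(1) arg_min_least)
  have less: "e m < e k" if "k \<in> J'" "k \<noteq> m" for k
    using m(1) m(2)[OF that(1)] that assms(2) by (force simp: J'_def inj_on_def order_le_less)
  have lim0: "((\<lambda>s::real. s powr a) \<longlongrightarrow> 0) (at_right 0)" if "a > 0" for a
    by (rule tendsto_zero_powrI[OF tendsto_ident_at tendsto_const _ that])
       (simp add: eventually_at_right_less eventually_mono[OF eventually_at_right_less])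
  have "((\<lambda>s. \<Sum>k\<in>J'. c k * s powr (e k - e m)) \<longlongrightarrow> (\<Sum>k\<in>J'. if k = m then c k else 0)) (at_right 0)"
  proof (rule tendsto_sum)
    fix k assume k: "k \<in> J'"
    show "((\<lambda>s. c k * s powr (e k - e m)) \<longlongrightarrow> (if k = m then c k else 0)) (at_right 0)"
    proof (cases "k = m")
      case True
      have "\<forall>\<^sub>F s in at_right 0. c k = c k * s powr (e k - e m)"
        using eventually_at_right_less[of "0::real"] by eventually_elim (simp add: True)
      then show ?thesis using True by (auto intro: tendsto_eventually elim: eventually_mono)
    next
      case False
      then show ?thesis using lim0[of "e k - e m"] less[OF k] by (auto intro: tendsto_mult_right_zero)
    qed
  qed
  then have "((\<lambda>s. \<bar>\<Sum>k\<in>J'. c k * s powr (e k - e m)\<bar> - C * s powr (K - e m)) \<longlongrightarrow> \<bar>c m\<bar> - 0) (at_right 0)"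
    using J' m K lim0[of "K - e m"]
    by (intro tendsto_diff tendsto_rabs tendsto_mult_right_zero) (auto simp: J'_def)
  moreover have "\<bar>c m\<bar> - 0 > 0" using m by (auto simp: J'_def)
  ultimately have "\<forall>\<^sub>F s in at_right 0. \<bar>\<Sum>k\<in>J'. c k * s powr (e k - e m)\<bar> - C * s powr (K - e m) > 0"
    by (rule order_tendstoD)
  then have "\<forall>\<^sub>F s in at_right 0. \<not> \<bar>\<Sum>j\<in>J. c j * s powr e j\<bar> \<le> C * s powr K"
    using eventually_at_right_less[of "0::real"]
  proof eventually_elim
    case (elim s)
    have "(\<Sum>j\<in>J. c j * s powr e j) = (\<Sum>j\<in>J'. c j * s powr e j)"
      by (rule sum.mono_neutral_right) (auto simp: J'_def assms)
    also have "\<dots> = s powr e m * (\<Sum>k\<in>J'. c k * s powr (e k - e m))"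
      unfolding sum_distrib_left using elim(2)
      by (intro sum.cong) (auto simp: mult.left_commute simp flip: powr_add)
    finally have "\<bar>\<Sum>j\<in>J. c j * s powr e j\<bar> = s powr e m * \<bar>\<Sum>k\<in>J'. c k * s powr (e k - e m)\<bar>"
      using elim(2) by (simp add: abs_mult)
    moreover have "C * s powr K = s powr e m * (C * s powr (K - e m))"
    proof -
      have "s powr K = s powr e m * s powr (K - e m)" by (simp flip: powr_add)
      then show ?thesis by (simp only: mult.left_commute)
    qed
    moreover have "s powr e m * (C * s powr (K - e m)) < s powr e m * \<bar>\<Sum>k\<in>J'. c k * s powr (e k - e m)\<bar>"
      using elim by (intro mult_strict_left_mono) auto
    ultimately show ?case by linarith
  qed
  then show False using freq by (simp add: frequently_def)
qed

text \<open>Comparing first order terms at the singularity would not suffice below: in dimension one the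
  relation imposed on the coefficients by the leading exponents is empty.\<close>

definition affine_mod_square :: "(real \<Rightarrow> real) \<Rightarrow> bool" where
  "affine_mod_square f \<longleftrightarrow> (\<exists>p q C. \<forall>s\<in>{0<..<1}. \<bar>f s - (p + q * s)\<bar> \<le> C * s\<^sup>2)"

text \<open>Taylor expansion at 0. With \<open>a > 0\<close> the base stays away from the
  singularity, and \<open>r \<le> 2\<close> makes the exponent \<open>r - 2\<close> nonpositive, so
  that the power in the second derivative is largest at 0.\<close>

lemma affine_mod_square_powr:
  assumes "a > 0" "b \<ge> 0" "r \<le> 2"
  shows "affine_mod_square (\<lambda>s. (a + b * s) powr r)"
  unfolding affine_mod_square_def
proof (intro exI ballI)
  fix s :: real assume s: "s \<in> {0<..<1}"
  define D where "D m = (if m = (0::nat) then (\<lambda>s. (a + b * s) powr r)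
     else if m = 1 then (\<lambda>s. r * b * (a + b * s) powr (r - 1))
     else (\<lambda>s. r * (r - 1) * b\<^sup>2 * (a + b * s) powr (r - 2)))" for m
  have pos: "a + b * t > 0" if "t \<ge> 0" for t
    using assms that by (simp add: add_pos_nonneg)
  have "\<forall>m t. m < 2 \<and> 0 \<le> t \<and> t \<le> s \<longrightarrow> (D m has_real_derivative D (Suc m) t) (at t)"
  proof (intro allI impI, elim conjE)
    fix m :: nat and t assume "m < 2" "0 \<le> t" "t \<le> s"
    moreover have "((\<lambda>s. (a + b * s) powr r) has_real_derivative r * b * (a + b * t) powr (r - 1)) (at t)" for r
      using pos[of t] \<open>0 \<le> t\<close> by (auto intro!: derivative_eq_intros simp: mult_ac)
    from this[of r] DERIV_cmult[OF this[of "r - 1"], of "r * b"]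
    show "(D m has_real_derivative D (Suc m) t) (at t)"
      using \<open>m < 2\<close> by (auto simp: D_def less_2_cases_iff power2_eq_square mult_ac)
  qed
  from Maclaurin2[OF _ _ this, of "D 0"] s obtain t where t: "0 < t" "t \<le> s"
    and eq: "D 0 s = (\<Sum>m<2. D m 0 / fact m * s ^ m) + D 2 t / fact 2 * s\<^sup>2"
    by auto
  have "(a + b * t) powr (r - 2) \<le> a powr (r - 2)"
    using assms t by (intro powr_mono2') auto
  then have "\<bar>D 2 t\<bar> \<le> \<bar>r * (r - 1) * b\<^sup>2\<bar> * a powr (r - 2)"
    by (auto simp: D_def abs_mult intro!: mult_left_mono)
  then have "\<bar>D 2 t\<bar> / 2 * s\<^sup>2 \<le> \<bar>r * (r - 1) * b\<^sup>2\<bar> * a powr (r - 2) * s\<^sup>2"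
    by (intro mult_right_mono) auto
  then have "\<bar>D 2 t / fact 2 * s\<^sup>2\<bar> \<le> \<bar>r * (r - 1) * b\<^sup>2\<bar> * a powr (r - 2) * s\<^sup>2"
    by (simp only: abs_mult abs_divide fact_2 abs_power2 abs_numeral)
  then show "\<bar>(a + b * s) powr r - (a powr r + r * b * a powr (r - 1) * s)\<bar>
      \<le> \<bar>r * (r - 1) * b\<^sup>2\<bar> * a powr (r - 2) * s\<^sup>2"
    using eq by (simp add: D_def numeral_2_eq_2)
qed

lemma affine_mod_square_mult_affine:
  assumes "affine_mod_square f"
  shows "affine_mod_square (\<lambda>s. f s * (u + v * s))"
proof -
  from assms obtain p q C where *: "\<And>s. s \<in> {0<..<1} \<Longrightarrow> \<bar>f s - (p + q * s)\<bar> \<le> C * s\<^sup>2"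
    unfolding affine_mod_square_def by blast
  have "\<bar>f s * (u + v * s) - (p * u + (p * v + q * u) * s)\<bar> \<le> (C * (\<bar>u\<bar> + \<bar>v\<bar>) + \<bar>q * v\<bar>) * s\<^sup>2"
    if s: "s \<in> {0<..<1}" for s
  proof -
    have "f s * (u + v * s) - (p * u + (p * v + q * u) * s) = (f s - (p + q * s)) * (u + v * s) + q * v * s\<^sup>2"
      by (simp add: algebra_simps power2_eq_square)
    moreover have "\<bar>u + v * s\<bar> \<le> \<bar>u\<bar> + \<bar>v\<bar>"
      using s abs_triangle_ineq[of u "v * s"] mult_left_le[of s "\<bar>v\<bar>"] by (simp add: abs_mult)
    then have "\<bar>(f s - (p + q * s)) * (u + v * s)\<bar> \<le> C * s\<^sup>2 * (\<bar>u\<bar> + \<bar>v\<bar>)"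
      unfolding abs_mult using *[OF s] by (intro mult_mono) auto
    moreover have "\<bar>q * v * s\<^sup>2\<bar> = \<bar>q * v\<bar> * s\<^sup>2" by (simp add: abs_mult)
    moreover have "(C * (\<bar>u\<bar> + \<bar>v\<bar>) + \<bar>q * v\<bar>) * s\<^sup>2 = C * s\<^sup>2 * (\<bar>u\<bar> + \<bar>v\<bar>) + \<bar>q * v\<bar> * s\<^sup>2"
      by (simp add: algebra_simps)
    ultimately show ?thesis
      using abs_triangle_ineq[of "(f s - (p + q * s)) * (u + v * s)" "q * v * s\<^sup>2"]
      by linarith
  qed
  then show ?thesis unfolding affine_mod_square_def by blast
qed

lemma affine_mod_square_sum:
  assumes "\<And>i. i \<in> I \<Longrightarrow> affine_mod_square (f i)"
  shows "affine_mod_square (\<lambda>s. \<Sum>i\<in>I. f i s)"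
proof -
  from assms obtain p q C
    where *: "\<And>i s. i \<in> I \<Longrightarrow> s \<in> {0<..<1} \<Longrightarrow> \<bar>f i s - (p i + q i * s)\<bar> \<le> C i * s\<^sup>2"
    unfolding affine_mod_square_def by metis
  have "\<bar>(\<Sum>i\<in>I. f i s) - (sum p I + sum q I * s)\<bar> \<le> sum C I * s\<^sup>2" if "s \<in> {0<..<1}" for s
  proof -
    have "(\<Sum>i\<in>I. f i s) - (sum p I + sum q I * s) = (\<Sum>i\<in>I. f i s - (p i + q i * s))"
      by (simp add: sum_subtractf sum.distrib sum_distrib_right)
    also have "\<bar>\<dots>\<bar> \<le> (\<Sum>i\<in>I. C i * s\<^sup>2)"
      by (rule order_trans[OF sum_abs sum_mono]) (use * that in auto)
    finally show ?thesis by (simp add: sum_distrib_right)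
  qed
  then show ?thesis unfolding affine_mod_square_def by blast
qed

text \<open>The real identity extends to complex \<open>t\<close> in a half plane, hence along the real axis up to
  the first singularity \<open>1 / b\<close>.\<close>

lemma powr_sum_continuation:
  fixes \<beta> :: "'i \<Rightarrow> real" and \<alpha> :: "'j \<Rightarrow> real"
  assumes \<beta>: "\<And>i. i \<in> I \<Longrightarrow> 0 < \<beta> i \<and> \<beta> i \<le> b" and "b > 0" "\<epsilon> > 0"
    and zero: "\<And>t. 0 < t \<Longrightarrow> t < \<epsilon> \<Longrightarrow>
      (\<Sum>i\<in>I. \<Sum>j\<in>J. (1 - \<beta> i * t) powr \<alpha> j * (A i j + t * B i j)) = 0"
    and t: "0 < t" "t < 1 / b"
  shows "(\<Sum>i\<in>I. \<Sum>j\<in>J. (1 - \<beta> i * t) powr \<alpha> j * (A i j + t * B i j)) = 0"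
proof -
  define F where "F z = (\<Sum>i\<in>I. \<Sum>j\<in>J. (1 - of_real (\<beta> i) * z) powr of_real (\<alpha> j)
      * (of_real (A i j) + z * of_real (B i j)))" for z :: complex
  \<comment> \<open>On this half plane every base \<open>1 - \<beta> i * z\<close> has positive real
    part, hence avoids the branch cut of the complex power.\<close>
  define S where "S = {z :: complex. Re z < 1 / b}"
  have pos: "1 - \<beta> i * x > 0" if "i \<in> I" "x < 1 / b" for i x
  proof (cases "x \<le> 0")
    case True
    then have "\<beta> i * x \<le> 0" using \<beta>[OF that(1)] by (simp add: mult_le_0_iff)
    then show ?thesis by simp
  next
    case False
    have "\<beta> i * x \<le> b * x" using \<beta>[OF that(1)] False by (intro mult_right_mono) auto
    also have "\<dots> < 1" using that \<open>b > 0\<close> by (simp add: field_simps)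
    finally show ?thesis by simp
  qed
  have F_real: "F (of_real x) = of_real (\<Sum>i\<in>I. \<Sum>j\<in>J. (1 - \<beta> i * x) powr \<alpha> j * (A i j + x * B i j))"
    if "x < 1 / b" for x
  proof -
    have "(1 - of_real (\<beta> i) * of_real x) powr of_real (\<alpha> j) = (of_real ((1 - \<beta> i * x) powr \<alpha> j) :: complex)"
      if "i \<in> I" for i j
      using powr_of_real[of "1 - \<beta> i * x" "\<alpha> j"] pos[OF that \<open>x < 1 / b\<close>] by simp
    then show ?thesis by (simp add: F_def)
  qed
  define \<epsilon>' where "\<epsilon>' = min \<epsilon> (1 / b)"
  have "\<epsilon>' > 0" using assms by (simp add: \<epsilon>'_def)
  have "F (of_real t) = 0"
  proof (rule analytic_continuation[where f = F and w = "of_real t" and S = S and U = "of_real ` {0<..<\<epsilon>'}" and \<xi> = 0])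
    show "F holomorphic_on S" unfolding F_def
    proof (intro holomorphic_intros)
      fix z i assume "i \<in> I" "z \<in> S"
      then show "1 - of_real (\<beta> i) * z \<notin> \<real>\<^sub>\<le>\<^sub>0"
        using pos[of i "Re z"] by (auto simp: S_def complex_nonpos_Reals_iff)
    qed
    show "open S" "connected S" unfolding S_def
      by (simp_all add: open_halfspace_Re_lt convex_connected convex_halfspace_Re_lt)
    show "of_real ` {0<..<\<epsilon>'} \<subseteq> S" by (auto simp: S_def \<epsilon>'_def)
    show "0 \<in> S" "of_real t \<in> S" using t assms by (auto simp: S_def)
    show "(0::complex) islimpt of_real ` {0<..<\<epsilon>'}"
      unfolding islimpt_approachable
    proof (intro allI impI)
      fix e :: real assume "e > 0"
      then show "\<exists>x'\<in>of_real ` {0<..<\<epsilon>'}. x' \<noteq> 0 \<and> dist x' (0::complex) < e"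
        using \<open>\<epsilon>' > 0\<close> by (intro bexI[OF _ imageI[of "min e \<epsilon>' / 2"]]) (auto simp: min_def)
    qed
    show "F z = 0" if "z \<in> of_real ` {0<..<\<epsilon>'}" for z
    proof -
      obtain x where "z = of_real x" "0 < x" "x < \<epsilon>" "x < 1 / b" using \<open>z \<in> _\<close> by (auto simp: \<epsilon>'_def)
      show ?thesis unfolding \<open>z = _\<close> F_real[OF \<open>x < 1 / b\<close>] zero[OF \<open>0 < x\<close> \<open>x < \<epsilon>\<close>] by (rule of_real_0)
    qed
  qed
  with F_real[OF t(2)] have "complex_of_real (\<Sum>i\<in>I. \<Sum>j\<in>J. (1 - \<beta> i * t) powr \<alpha> j * (A i j + t * B i j)) = 0"
    by (rule subst)
  then show ?thesis by (simp only: of_real_eq_0_iff)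
qed

lemma powr_sum_independent:
  fixes \<beta> :: "'i \<Rightarrow> real" and \<alpha> :: "'j \<Rightarrow> real"
  assumes "finite I" "finite J" "inj_on \<beta> I" "\<And>i. i \<in> I \<Longrightarrow> 0 < \<beta> i"
    and inj: "inj_on \<alpha> J" and \<alpha>: "\<And>j. j \<in> J \<Longrightarrow> 0 < \<alpha> j \<and> \<alpha> j < 1" and "\<epsilon> > 0"
    and "\<And>t. 0 < t \<Longrightarrow> t < \<epsilon> \<Longrightarrow>
      (\<Sum>i\<in>I. \<Sum>j\<in>J. (1 - \<beta> i * t) powr \<alpha> j * (A i j + t * B i j)) = 0"
  shows "\<forall>i\<in>I. \<forall>j\<in>J. A i j = 0 \<and> B i j = 0"
  using assms(1,3,4,8)
\<comment> \<open>The ranking induction inserts an index \<open>m\<close> with the largest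
  \<open>\<beta>\<close> so far, but does not guarantee that it is new; hence the case
  split.\<close>
proof (induction I rule: finite_ranking_induct[where f = \<beta>])
  case (insert m I)
  show ?case
  proof (cases "m \<in> I")
    case True
    with insert show ?thesis by (simp add: insert_absorb)
  next
    case False
    define b where "b = \<beta> m"
    have "b > 0" using insert.prems by (simp add: b_def)
    have less: "0 < \<beta> i \<and> \<beta> i < b" if "i \<in> I" for i
    proof -
      have "\<beta> i \<noteq> \<beta> m" using insert.prems(1) that False by (auto simp: inj_on_def)
      then show ?thesis using insert.prems(2)[of i] insert.hyps(2)[OF that] that by (simp add: b_def)
    qed
    have cont: "(\<Sum>i\<in>insert m I. \<Sum>j\<in>J. (1 - \<beta> i * t) powr \<alpha> j * (A i j + t * B i j)) = 0"
      if "0 < t" "t < 1 / b" for t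
    proof (rule powr_sum_continuation[where b = b and \<epsilon> = \<epsilon>])
      show "0 < \<beta> i \<and> \<beta> i \<le> b" if "i \<in> insert m I" for i
        using that less[of i] \<open>b > 0\<close> by (auto simp: b_def)
    qed (use \<open>b > 0\<close> \<open>\<epsilon> > 0\<close> insert.prems(3) that in blast)+
    \<comment> \<open>The terms of the other indices at \<open>t = (1 - s) / b\<close>.\<close>
    define R where "R s = (\<Sum>i\<in>I. \<Sum>j\<in>J. ((1 - \<beta> i / b) + \<beta> i / b * s) powr \<alpha> j
       * ((A i j + B i j / b) + (- B i j / b) * s))" for s
    have "affine_mod_square R" unfolding R_def
    proof (intro affine_mod_square_sum affine_mod_square_mult_affine affine_mod_square_powr)
      fix i j assume "i \<in> I" "j \<in> J"
      then show "0 < 1 - \<beta> i / b" "0 \<le> \<beta> i / b" "\<alpha> j \<le> 2"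
        using less[of i] \<alpha>[of j] \<open>b > 0\<close> by auto
    qed
    then obtain p q C where R: "\<And>s. s \<in> {0<..<1} \<Longrightarrow> \<bar>R s - (p + q * s)\<bar> \<le> C * s\<^sup>2"
      unfolding affine_mod_square_def by blast
    \<comment> \<open>Index \<open>None\<close> stands for the affine part \<open>p + q * s\<close>
      of \<open>R\<close>, index \<open>Some j\<close> for the singular terms of \<open>m\<close>;
      the second component is an additional integer power of \<open>s\<close>.\<close>
    define e where "e = (\<lambda>(x, k). (case x of None \<Rightarrow> 0 | Some j \<Rightarrow> \<alpha> j) + real k)"
    define c where "c = (\<lambda>(x, k :: nat). case x of None \<Rightarrow> (if k = 0 then p else q)
        | Some j \<Rightarrow> if k = 0 then A m j + B m j / b else - B m j / b)"
    define K where "K = insert None (Some ` J) \<times> {0, 1 :: nat}"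
    have "finite K" using \<open>finite J\<close> by (simp add: K_def)
    have sum_K: "(\<Sum>k\<in>K. c k * s powr e k)
      = p + q * s + (\<Sum>j\<in>J. s powr \<alpha> j * ((A m j + B m j / b) + (- B m j / b) * s))"
      if "s > 0" for s
    proof -
      have "(\<Sum>k\<in>K. c k * s powr e k)
        = (\<Sum>x\<in>insert None (Some ` J). \<Sum>k\<in>{0, 1}. c (x, k) * s powr e (x, k))"
        unfolding K_def by (subst sum.cartesian_product) (intro sum.cong, auto)
      also have "\<dots> = p + q * s + (\<Sum>j\<in>J. c (Some j, 0) * s powr e (Some j, 0)
          + c (Some j, 1) * s powr e (Some j, 1))"
        using that \<open>finite J\<close> by (simp add: c_def e_def sum.reindex sum.insert)
      also have "(\<Sum>j\<in>J. c (Some j, 0) * s powr e (Some j, 0) + c (Some j, 1) * s powr e (Some j, 1))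
        = (\<Sum>j\<in>J. s powr \<alpha> j * ((A m j + B m j / b) + (- B m j / b) * s))"
        using that by (intro sum.cong) (auto simp: c_def e_def powr_add algebra_simps)
      finally show ?thesis .
    qed
    have bound: "\<bar>\<Sum>k\<in>K. c k * s powr e k\<bar> \<le> C * s powr 2" if s: "s \<in> {0<..<1}" for s
    proof -
      have t: "0 < (1 - s) / b" "(1 - s) / b < 1 / b" using s \<open>b > 0\<close> by (auto simp: field_simps)
      have m: "1 - \<beta> m * ((1 - s) / b) = s" using \<open>b > 0\<close> by (simp add: b_def)
      have i: "1 - \<beta> i * ((1 - s) / b) = (1 - \<beta> i / b) + \<beta> i / b * s" for i
        using \<open>b > 0\<close> by (simp add: field_simps)
      have AB: "A i j + (1 - s) / b * B i j = (A i j + B i j / b) + (- B i j / b) * s" for i j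
        using \<open>b > 0\<close> by (simp add: field_simps)
      have "(\<Sum>j\<in>J. s powr \<alpha> j * ((A m j + B m j / b) + (- B m j / b) * s)) + R s = 0"
        using cont[OF t] unfolding sum.insert[OF \<open>finite I\<close> False] m AB
        unfolding R_def i .
      then have "(\<Sum>k\<in>K. c k * s powr e k) = - (R s - (p + q * s))"
        using sum_K[of s] s by simp
      then show ?thesis using R[OF s] s by (simp add: powr_numeral)
    qed
    have "c k = 0" if "k \<in> K" for k
    proof (rule powr_sum_dominated_imp_zero[OF \<open>finite K\<close> _ _ _ that])
      show "inj_on e K"
      proof (rule inj_onI)
        fix u v assume "u \<in> K" "v \<in> K" and eq: "e u = e v"
        then obtain x k y l where uv: "u = (x, k)" "v = (y, l)" "k < 2" "l < 2"
          and xy: "x \<in> insert None (Some ` J)" "y \<in> insert None (Some ` J)"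
          by (auto simp: K_def)
        \<comment> \<open>The exponent splits into the fractional part \<open>a x\<close> in [0,1)
          and the integer part \<open>real k\<close>. Since every \<open>\<alpha> j\<close> is
          positive, fractional part 0 belongs to \<open>None\<close> alone.\<close>
        define a where "a = case_option 0 \<alpha>"
        have a: "0 \<le> a x" "a x < 1" "0 \<le> a y" "a y < 1" using xy \<alpha> by (auto simp: a_def less_imp_le)
        have *: "a x + real k = a y + real l" using eq by (simp add: e_def uv a_def)
        with a have "real k < real l + 1" "real l < real k + 1" by linarith+
        then have "k = l" by linarith
        with * have "a x = a y" by simp
        have "x = y"
        proof (cases x)
          case None
          then have "a y = 0" using \<open>a x = a y\<close> by (simp add: a_def)
          have False if "y = Some j" for j using \<open>a y = 0\<close> that xy(2) \<alpha>[of j] by (auto simp: a_def)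
          then show ?thesis using None by (cases y) auto
        next
          case (Some i)
          then have "a x \<noteq> 0" "i \<in> J" using xy(1) \<alpha>[of i] by (auto simp: a_def)
          then obtain j where "y = Some j" "j \<in> J" using xy(2) \<open>a x = a y\<close> by (auto simp: a_def)
          then show ?thesis using Some \<open>i \<in> J\<close> \<open>a x = a y\<close> inj by (auto simp: a_def inj_on_def)
        qed
        then show "u = v" using \<open>k = l\<close> by (simp add: uv)
      qed
      show "e k < 2" if "k \<in> K" for k using that by (auto simp: e_def K_def dest: \<alpha>)
      have "\<forall>\<^sub>F s in at_right 0. s \<in> {0<..<1::real}" by (rule eventually_at_right_real) simp
      then have "\<forall>\<^sub>F s in at_right 0. \<bar>\<Sum>k\<in>K. c k * s powr e k\<bar> \<le> C * s powr 2"
        by (rule eventually_mono) (rule bound)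
      then show "\<exists>\<^sub>F s in at_right 0. \<bar>\<Sum>k\<in>K. c k * s powr e k\<bar> \<le> C * s powr 2"
        by (rule eventually_frequently[rotated]) simp
    qed
    have m: "A m j = 0 \<and> B m j = 0" if "j \<in> J" for j
      using that \<open>b > 0\<close> \<open>\<And>k. k \<in> K \<Longrightarrow> c k = 0\<close>[of "(Some j, 0)"]
        \<open>\<And>k. k \<in> K \<Longrightarrow> c k = 0\<close>[of "(Some j, 1)"] by (simp add: c_def K_def)
    moreover have "\<forall>i\<in>I. \<forall>j\<in>J. A i j = 0 \<and> B i j = 0"
    proof (rule insert.IH)
      show "inj_on \<beta> I" "\<And>i. i \<in> I \<Longrightarrow> 0 < \<beta> i" using insert.prems by auto
      show "(\<Sum>i\<in>I. \<Sum>j\<in>J. (1 - \<beta> i * t) powr \<alpha> j * (A i j + t * B i j)) = 0"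
        if "0 < t" "t < \<epsilon>" for t
        using insert.prems(3)[OF that] False \<open>finite I\<close> m by simp
    qed
    ultimately show ?thesis by simp
  qed
qed simp

section \<open>Strict derivatives and local surjectivity\<close>

text \<open>Strict Frechet differentiability: a condition at a single point, stable under
  composition, and strong enough for Newton's iteration with a frozen derivative.\<close>

definition has_strict_derivative ::
    "('a::real_normed_vector \<Rightarrow> 'b::real_normed_vector) \<Rightarrow> ('a \<Rightarrow> 'b) \<Rightarrow> 'a \<Rightarrow> bool" where
  "has_strict_derivative f f' x \<longleftrightarrow> bounded_linear f' \<and>
     (\<forall>e>0. \<exists>d>0. \<forall>y\<in>ball x d. \<forall>z\<in>ball x d. norm (f y - f z - f' (y - z)) \<le> e * norm (y - z))"

lemma has_strict_derivativeD:
  assumes "has_strict_derivative f f' x" "e > 0"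
  obtains d where "d > 0"
    "\<And>y z. y \<in> ball x d \<Longrightarrow> z \<in> ball x d \<Longrightarrow> norm (f y - f z - f' (y - z)) \<le> e * norm (y - z)"
  using assms unfolding has_strict_derivative_def by metis

lemma has_strict_derivative_lipschitz:
  assumes "has_strict_derivative f f' x"
  obtains K d where "K > 0" "d > 0"
    "\<And>y z. y \<in> ball x d \<Longrightarrow> z \<in> ball x d \<Longrightarrow> norm (f y - f z) \<le> K * norm (y - z)"
proof -
  interpret bounded_linear f' using assms by (simp add: has_strict_derivative_def)
  obtain M where M: "M > 0" "\<And>v. norm (f' v) \<le> norm v * M" using pos_bounded by blast
  obtain d where d: "d > 0"
    "\<And>y z. y \<in> ball x d \<Longrightarrow> z \<in> ball x d \<Longrightarrow> norm (f y - f z - f' (y - z)) \<le> 1 * norm (y - z)"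
    using has_strict_derivativeD[OF assms zero_less_one] by blast
  have "norm (f y - f z) \<le> (1 + M) * norm (y - z)" if "y \<in> ball x d" "z \<in> ball x d" for y z
    using d(2)[OF that] M(2)[of "y - z"] norm_triangle_ineq[of "f y - f z - f' (y - z)" "f' (y - z)"]
    by (simp add: algebra_simps)
  then show thesis using that[of "1 + M" d] M d by auto
qed

lemma has_strict_derivative_isCont:
  assumes "has_strict_derivative f f' x"
  shows "isCont f x"
proof -
  obtain K d where K: "K > 0" "d > 0"
    "\<And>y z. y \<in> ball x d \<Longrightarrow> z \<in> ball x d \<Longrightarrow> norm (f y - f z) \<le> K * norm (y - z)"
    using has_strict_derivative_lipschitz[OF assms] by blast
  show ?thesis unfolding continuous_at_eps_delta
  proof (intro allI impI)
    fix e :: real assume "e > 0"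
    show "\<exists>r>0. \<forall>y. dist y x < r \<longrightarrow> dist (f y) (f x) < e"
    proof (intro exI[of _ "min d (e / K)"] conjI allI impI)
      show "min d (e / K) > 0" using K \<open>e > 0\<close> by simp
      fix y assume "dist y x < min d (e / K)"
      then have y: "dist y x < d" "K * dist y x < e" using K by (auto simp: field_simps)
      have "norm (f y - f x) \<le> K * norm (y - x)" using K y by (simp add: dist_commute)
      then show "dist (f y) (f x) < e" using y by (simp add: dist_norm)
    qed
  qed
qed

lemma has_strict_derivative_bounded_linear:
  "bounded_linear f \<Longrightarrow> has_strict_derivative f f x"
  unfolding has_strict_derivative_def
  by (auto simp: linear_diff bounded_linear.linear intro!: exI[of _ 1])

lemma has_strict_derivative_const: "has_strict_derivative (\<lambda>_. c) (\<lambda>_. 0) x"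
  unfolding has_strict_derivative_def by (auto intro!: exI[of _ 1])

lemma has_strict_derivative_add:
  assumes "has_strict_derivative f f' x" "has_strict_derivative g g' x"
  shows "has_strict_derivative (\<lambda>x. f x + g x) (\<lambda>v. f' v + g' v) x"
  unfolding has_strict_derivative_def
proof (intro conjI allI impI)
  show "bounded_linear (\<lambda>v. f' v + g' v)"
    using assms by (simp add: has_strict_derivative_def bounded_linear_add)
  fix e :: real assume "e > 0"
  then have "e / 2 > 0" by simp
  obtain d1 where d1: "d1 > 0"
    "\<And>y z. y \<in> ball x d1 \<Longrightarrow> z \<in> ball x d1 \<Longrightarrow> norm (f y - f z - f' (y - z)) \<le> e / 2 * norm (y - z)"
    using has_strict_derivativeD[OF assms(1) \<open>e / 2 > 0\<close>] by blast
  obtain d2 where d2: "d2 > 0"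
    "\<And>y z. y \<in> ball x d2 \<Longrightarrow> z \<in> ball x d2 \<Longrightarrow> norm (g y - g z - g' (y - z)) \<le> e / 2 * norm (y - z)"
    using has_strict_derivativeD[OF assms(2) \<open>e / 2 > 0\<close>] by blast
  have "norm (f y + g y - (f z + g z) - (f' (y - z) + g' (y - z))) \<le> e * norm (y - z)"
    if "y \<in> ball x (min d1 d2)" "z \<in> ball x (min d1 d2)" for y z
  proof -
    have "f y + g y - (f z + g z) - (f' (y - z) + g' (y - z))
        = (f y - f z - f' (y - z)) + (g y - g z - g' (y - z))" by (simp add: algebra_simps)
    then have "norm (f y + g y - (f z + g z) - (f' (y - z) + g' (y - z)))
        \<le> norm (f y - f z - f' (y - z)) + norm (g y - g z - g' (y - z))"
      by (simp only: norm_triangle_ineq)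
    then show ?thesis using d1(2)[of y z] d2(2)[of y z] that by simp
  qed
  then show "\<exists>d>0. \<forall>y\<in>ball x d. \<forall>z\<in>ball x d.
      norm (f y + g y - (f z + g z) - (f' (y - z) + g' (y - z))) \<le> e * norm (y - z)"
    using d1(1) d2(1) by (intro exI[of _ "min d1 d2"]) auto
qed

lemma has_strict_derivative_compose:
  assumes f: "has_strict_derivative f f' x" and g: "has_strict_derivative g g' (f x)"
  shows "has_strict_derivative (\<lambda>x. g (f x)) (\<lambda>v. g' (f' v)) x"
  unfolding has_strict_derivative_def
proof (intro conjI allI impI)
  show "bounded_linear (\<lambda>v. g' (f' v))"
    using assms by (simp add: has_strict_derivative_def bounded_linear_compose)
  interpret g': bounded_linear g' using g by (simp add: has_strict_derivative_def)
  fix e :: real assume "e > 0"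
  obtain M where M: "M > 0" "\<And>v. norm (g' v) \<le> norm v * M" using g'.pos_bounded by blast
  obtain K d1 where K: "K > 0" "d1 > 0"
    "\<And>y z. y \<in> ball x d1 \<Longrightarrow> z \<in> ball x d1 \<Longrightarrow> norm (f y - f z) \<le> K * norm (y - z)"
    using has_strict_derivative_lipschitz[OF f] by blast
  \<comment> \<open>Half of \<open>e\<close> goes to the error of \<open>g\<close>, enlarged by the
    Lipschitz constant \<open>K\<close> of \<open>f\<close>; the other half to the error of
    \<open>f\<close>, enlarged by the bound \<open>M\<close> of \<open>g'\<close>.\<close>
  have pos: "e / (2 * K) > 0" "e / (2 * M) > 0" using \<open>e > 0\<close> K M by auto
  obtain d2 where d2: "d2 > 0" "\<And>y z. y \<in> ball (f x) d2 \<Longrightarrow> z \<in> ball (f x) d2 \<Longrightarrow>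
      norm (g y - g z - g' (y - z)) \<le> e / (2 * K) * norm (y - z)"
    using has_strict_derivativeD[OF g pos(1)] by blast
  obtain d3 where d3: "d3 > 0" "\<And>y z. y \<in> ball x d3 \<Longrightarrow> z \<in> ball x d3 \<Longrightarrow>
      norm (f y - f z - f' (y - z)) \<le> e / (2 * M) * norm (y - z)"
    using has_strict_derivativeD[OF f pos(2)] by blast
  define d where "d = min (min d1 d3) (d2 / K)"
  have fb: "f y \<in> ball (f x) d2" if "y \<in> ball x d" for y
  proof -
    have "norm (f x - f y) \<le> K * norm (x - y)" using that K by (auto simp: d_def)
    also have "\<dots> < d2" using that K by (auto simp: d_def dist_norm field_simps)
    finally show ?thesis by (simp add: dist_norm)
  qed
  have "norm (g (f y) - g (f z) - g' (f' (y - z))) \<le> e * norm (y - z)"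
    if y: "y \<in> ball x d" and z: "z \<in> ball x d" for y z
  proof -
    have "g (f y) - g (f z) - g' (f' (y - z))
      = (g (f y) - g (f z) - g' (f y - f z)) + g' (f y - f z - f' (y - z))"
      by (simp add: g'.diff)
    then have "norm (g (f y) - g (f z) - g' (f' (y - z)))
      \<le> norm (g (f y) - g (f z) - g' (f y - f z)) + norm (g' (f y - f z - f' (y - z)))"
      by (simp only: norm_triangle_ineq)
    also have "norm (g (f y) - g (f z) - g' (f y - f z)) \<le> e / (2 * K) * norm (f y - f z)"
      using fb y z d2 by blast
    also have "\<dots> \<le> e / (2 * K) * (K * norm (y - z))"
      using K(3)[of y z] y z pos by (intro mult_left_mono) (auto simp: d_def)
    also have "norm (g' (f y - f z - f' (y - z))) \<le> e / (2 * M) * norm (y - z) * M"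
      using d3(2)[of y z] y z M(1) by (intro order_trans[OF M(2)] mult_right_mono) (auto simp: d_def)
    finally show ?thesis using K M by (simp add: field_simps)
  qed
  then show "\<exists>d>0. \<forall>y\<in>ball x d. \<forall>z\<in>ball x d.
      norm (g (f y) - g (f z) - g' (f' (y - z))) \<le> e * norm (y - z)"
    using K d2 d3 by (intro exI[of _ d]) (auto simp: d_def)
qed

text \<open>Mean value inequality for \<open>f - f' x\<close> on a ball where \<open>f' w\<close>
  differs from \<open>f' x\<close> by at most \<open>e\<close> in operator norm. In finite dimension
  the values on the basis control that norm, so continuity in the basis directions suffices.\<close>

lemma C1_imp_has_strict_derivative:
  fixes f :: "'a::euclidean_space \<Rightarrow> 'b::real_normed_vector"
  assumes "open U" "x \<in> U"
    and der: "\<And>y. y \<in> U \<Longrightarrow> (f has_derivative f' y) (at y)"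
    and cont: "\<And>b. b \<in> Basis \<Longrightarrow> isCont (\<lambda>y. f' y b) x"
  shows "has_strict_derivative f (f' x) x"
  unfolding has_strict_derivative_def
proof (intro conjI allI impI)
  show "bounded_linear (f' x)" using der[OF \<open>x \<in> U\<close>] by (rule has_derivative_bounded_linear)
  fix e :: real assume "e > 0"
  have "((\<lambda>y. \<Sum>b\<in>Basis. norm (f' y b - f' x b)) \<longlongrightarrow> (\<Sum>b\<in>Basis. norm (f' x b - f' x b))) (nhds x)"
    using cont tendsto_at_iff_tendsto_nhds[of "\<lambda>y. f' y _" x]
    by (intro tendsto_intros) (auto simp: isCont_def)
  then have "\<forall>\<^sub>F y in nhds x. (\<Sum>b\<in>Basis. norm (f' y b - f' x b)) < e"
    using \<open>e > 0\<close> by (intro order_tendstoD) auto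
  moreover have "\<forall>\<^sub>F y in nhds x. y \<in> U" using assms by (intro eventually_nhds_in_open)
  ultimately have "\<forall>\<^sub>F y in nhds x. y \<in> U \<and> (\<Sum>b\<in>Basis. norm (f' y b - f' x b)) < e"
    by eventually_elim simp
  then obtain d where d: "d > 0" "\<And>y. dist y x < d \<Longrightarrow> y \<in> U \<and> (\<Sum>b\<in>Basis. norm (f' y b - f' x b)) < e"
    unfolding eventually_nhds_metric by blast
  show "\<exists>d>0. \<forall>y\<in>ball x d. \<forall>z\<in>ball x d. norm (f y - f z - f' x (y - z)) \<le> e * norm (y - z)"
  proof (intro exI[of _ d] conjI ballI)
    fix y z assume yz: "y \<in> ball x d" "z \<in> ball x d"
    interpret x: bounded_linear "f' x" using der[OF \<open>x \<in> U\<close>] by (rule has_derivative_bounded_linear)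
    have "norm ((f y - f' x y) - (f z - f' x z)) \<le> e * norm (y - z)"
    proof (rule differentiable_bound[where S = "ball x d" and f' = "\<lambda>w v. f' w v - f' x v"])
      fix w assume "w \<in> ball x d"
      then have w: "w \<in> U" "(\<Sum>b\<in>Basis. norm (f' w b - f' x b)) < e"
        using d(2)[of w] by (auto simp: dist_commute)
      show "((\<lambda>y. f y - f' x y) has_derivative (\<lambda>v. f' w v - f' x v)) (at w within ball x d)"
        by (intro has_derivative_diff has_derivative_at_withinI[OF der[OF w(1)]]
            bounded_linear_imp_has_derivative x.bounded_linear_axioms)
      interpret w: bounded_linear "f' w" using der[OF w(1)] by (rule has_derivative_bounded_linear)
      show "onorm (\<lambda>v. f' w v - f' x v) \<le> e"
      proof (rule onorm_le)
        fix v
        have "f' w v - f' x v = (\<Sum>b\<in>Basis. (v \<bullet> b) *\<^sub>R (f' w b - f' x b))"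
          by (subst (1 2) euclidean_representation[of v, symmetric])
             (simp add: w.sum w.scale x.sum x.scale scaleR_diff_right sum_subtractf)
        also have "norm \<dots> \<le> (\<Sum>b\<in>Basis. norm v * norm (f' w b - f' x b))"
          by (intro order.trans[OF norm_sum] sum_mono) (simp add: Basis_le_norm mult_right_mono)
        also have "\<dots> = (\<Sum>b\<in>Basis. norm (f' w b - f' x b)) * norm v"
          by (simp add: sum_distrib_left mult.commute)
        also have "\<dots> \<le> e * norm v" using w(2) by (intro mult_right_mono) auto
        finally show "norm (f' w v - f' x v) \<le> e * norm v" .
      qed
    qed (use yz in auto)
    then show "norm (f y - f z - f' x (y - z)) \<le> e * norm (y - z)"
      by (simp add: x.diff algebra_simps)
  qed (use d in auto)
qed

text \<open>Newton's iteration with the derivative frozen at \<open>x\<close> is a contraction.\<close>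

lemma local_surjectivity:
  fixes G :: "'e::real_normed_vector \<Rightarrow> 'e"
  assumes "complete (UNIV :: 'e set)" "has_strict_derivative G (\<lambda>v. v) x" "r > 0"
  shows "\<exists>d>0. \<forall>y\<in>cball (G x) d. \<exists>z\<in>ball x r. G z = y"
proof -
  have "(1/2::real) > 0" by simp
  from has_strict_derivativeD[OF assms(2) this] obtain d where d: "d > 0"
    "\<And>y z. y \<in> ball x d \<Longrightarrow> z \<in> ball x d \<Longrightarrow> norm (G y - G z - (y - z)) \<le> 1/2 * norm (y - z)"
    by blast
  define \<rho> where "\<rho> = min d r / 2"
  have \<rho>: "\<rho> > 0" "\<rho> < d" "\<rho> < r" using d \<open>r > 0\<close> by (auto simp: \<rho>_def)
  have sub: "w \<in> ball x d" if "w \<in> cball x \<rho>" for w using that \<rho> by auto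
  \<comment> \<open>With targets within \<open>\<rho> / 2\<close>, the first iterate moves
    \<open>x\<close> by at most \<open>\<rho> / 2\<close> and the contraction adds at most
    \<open>\<rho> / 2\<close>, so \<open>cball x \<rho>\<close> is mapped into itself.\<close>
  have "\<exists>z\<in>ball x r. G z = y" if y: "y \<in> cball (G x) (\<rho> / 2)" for y
  proof -
    define T where "T z = z - (G z - y)" for z
    have T: "dist (T v) (T w) \<le> 1/2 * dist v w" if "v \<in> cball x \<rho>" "w \<in> cball x \<rho>" for v w
      using d(2)[OF sub[OF that(1)] sub[OF that(2)]] norm_minus_cancel[of "G v - G w - (v - w)"]
      by (simp add: T_def dist_norm algebra_simps)
    have "\<exists>!z\<in>cball x \<rho>. T z = z"
    proof (rule Banach_fix[where c = "1/2"])
      show "complete (cball x \<rho>)" using complete_Int_closed[OF assms(1), of "cball x \<rho>"] by simp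
      show "cball x \<rho> \<noteq> {}" using \<rho> by auto
      show "T ` cball x \<rho> \<subseteq> cball x \<rho>"
      proof (intro image_subsetI)
        fix z assume z: "z \<in> cball x \<rho>"
        have "dist (T x) x \<le> \<rho> / 2" using y by (simp add: T_def dist_norm norm_minus_commute)
        moreover have "dist (T z) (T x) \<le> \<rho> / 2" using T[OF z, of x] z \<rho> by (simp add: dist_commute)
        ultimately show "T z \<in> cball x \<rho>" using dist_triangle[of "T z" x "T x"] by (simp add: dist_commute)
      qed
    qed (use T in auto)
    then obtain z where "z \<in> cball x \<rho>" "T z = z" by blast
    then show ?thesis using \<rho> by (intro bexI[of _ z]) (auto simp: T_def)
  qed
  then show ?thesis using \<rho>(1) by (intro exI[of _ "\<rho> / 2"]) simp
qed

section \<open>Dual families\<close>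

definition finite_combination :: "'t set \<Rightarrow> ('t \<Rightarrow> 'k \<Rightarrow> real) \<Rightarrow> ('k \<Rightarrow> real) \<Rightarrow> bool" where
  "finite_combination T z f \<longleftrightarrow> (\<exists>F c. finite F \<and> F \<subseteq> T \<and> f = (\<lambda>k. \<Sum>t\<in>F. c t * z t k))"

lemma finite_combination_base: "t \<in> T \<Longrightarrow> finite_combination T z (z t)"
  unfolding finite_combination_def by (intro exI[of _ "{t}"] exI[of _ "\<lambda>_. 1"]) auto

lemma finite_combination_zero: "finite_combination T z (\<lambda>_. 0)"
  unfolding finite_combination_def by (intro exI[of _ "{}"]) auto

lemma finite_combination_scale:
  "finite_combination T z f \<Longrightarrow> finite_combination T z (\<lambda>k. a * f k)"
  unfolding finite_combination_def
  by (elim exE conjE, intro exI conjI, assumption, assumption)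
     (auto simp: sum_distrib_left mult.assoc[symmetric])

lemma finite_combination_add:
  assumes "finite_combination T z f" "finite_combination T z g"
  shows "finite_combination T z (\<lambda>k. f k + g k)"
proof -
  obtain F c where F: "finite F" "F \<subseteq> T" "f = (\<lambda>k. \<Sum>t\<in>F. c t * z t k)"
    using assms(1) unfolding finite_combination_def by blast
  obtain F' c' where F': "finite F'" "F' \<subseteq> T" "g = (\<lambda>k. \<Sum>t\<in>F'. c' t * z t k)"
    using assms(2) unfolding finite_combination_def by blast
  have "f k + g k = (\<Sum>t\<in>F \<union> F'. ((if t \<in> F then c t else 0) + (if t \<in> F' then c' t else 0)) * z t k)" for k
  proof -
    have "f k = (\<Sum>t\<in>F \<union> F'. (if t \<in> F then c t else 0) * z t k)"
      unfolding F(3) using F(1) F'(1) by (intro sum.mono_neutral_cong_left) auto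
    moreover have "g k = (\<Sum>t\<in>F \<union> F'. (if t \<in> F' then c' t else 0) * z t k)"
      unfolding F'(3) using F(1) F'(1) by (intro sum.mono_neutral_cong_left) auto
    ultimately show ?thesis by (simp add: distrib_right sum.distrib)
  qed
  then show ?thesis unfolding finite_combination_def
    using F(1,2) F'(1,2) by (intro exI conjI ext) auto
qed

lemma finite_combination_sum:
  assumes "finite A" "\<And>a. a \<in> A \<Longrightarrow> finite_combination T z (f a)"
  shows "finite_combination T z (\<lambda>k. \<Sum>a\<in>A. f a k)"
  using assms by (induction A) (auto intro: finite_combination_add finite_combination_zero)

text \<open>A subspace of a finite-dimensional space with trivial annihilator is the whole space.
  The induction on \<open>K\<close> is one round of Gaussian elimination.\<close>

lemma unit_vectors_if_no_annihilator:
  assumes "finite K"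
    and "\<And>l. \<forall>t\<in>T. (\<Sum>k\<in>K. l k * z t k) = 0 \<Longrightarrow> \<forall>k\<in>K. l k = 0"
    and "m \<in> K"
  shows "\<exists>f. finite_combination T z f \<and> (\<forall>k\<in>K. f k = of_bool (k = m))"
  using assms
proof (induction K arbitrary: m rule: finite_induct)
  case (insert p K)
  \<comment> \<open>A covector on \<open>K\<close> extends by 0 at \<open>p\<close>, so the smaller
    index set inherits the hypothesis.\<close>
  have "\<forall>k\<in>K. l k = 0" if l: "\<forall>t\<in>T. (\<Sum>k\<in>K. l k * z t k) = 0" for l
  proof -
    have "(\<Sum>k\<in>insert p K. (l(p := 0)) k * z t k) = 0" if "t \<in> T" for t
    proof -
      have "(\<Sum>k\<in>K. (l(p := 0)) k * z t k) = (\<Sum>k\<in>K. l k * z t k)"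
        using insert.hyps by (intro sum.cong) auto
      then show ?thesis using insert.hyps l that by simp
    qed
    then have "\<forall>k\<in>insert p K. (l(p := 0)) k = 0" by (intro insert.prems(1)) blast
    then show ?thesis using insert.hyps by (metis fun_upd_other insertCI)
  qed
  from insert.IH[OF this]
  have "\<forall>m\<in>K. \<exists>f. finite_combination T z f \<and> (\<forall>k\<in>K. f k = of_bool (k = m))" by blast
  then obtain f where f: "\<And>m. m \<in> K \<Longrightarrow> finite_combination T z (f m)"
    "\<And>m k. m \<in> K \<Longrightarrow> k \<in> K \<Longrightarrow> f m k = of_bool (k = m)" by metis
  \<comment> \<open>This covector kills every \<open>f m\<close> and is nonzero at \<open>p\<close>.
    Some \<open>z t\<close> must therefore escape it, and subtracting the
    \<open>K\<close>-coordinates of \<open>z t\<close> by means of the \<open>f m\<close> leaves a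
    vector supported, within \<open>insert p K\<close>, at \<open>p\<close> alone.\<close>
  define l where "l k = (if k = p then 1 else - f k p)" for k
  have "\<not> (\<forall>k\<in>insert p K. l k = 0)" by (auto simp: l_def)
  then obtain t where t: "t \<in> T" "(\<Sum>k\<in>insert p K. l k * z t k) \<noteq> 0"
    using insert.prems(1) by blast
  define g where "g k = z t k + (\<Sum>m\<in>K. (- z t m) * f m k)" for k
  have g: "finite_combination T z g" unfolding g_def
    by (intro finite_combination_add finite_combination_base finite_combination_sum
        finite_combination_scale f t insert.hyps)
  have gK: "g k = 0" if "k \<in> K" for k
  proof -
    have "(\<Sum>m\<in>K. (- z t m) * f m k) = (\<Sum>m\<in>K. if m = k then - z t k else 0)"
      using f(2) that by (intro sum.cong) auto
    then show ?thesis using that insert.hyps by (simp add: g_def)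
  qed
  have "g p = (\<Sum>k\<in>insert p K. l k * z t k)"
  proof -
    have "(\<Sum>k\<in>K. l k * z t k) = (\<Sum>m\<in>K. (- z t m) * f m p)"
      using insert.hyps by (intro sum.cong) (auto simp: l_def)
    then show ?thesis using insert.hyps by (simp add: g_def l_def)
  qed
  with t have gp: "g p \<noteq> 0" by simp
  define h where "h k = inverse (g p) * g k" for k
  have h: "finite_combination T z h" "h p = 1" "\<And>k. k \<in> K \<Longrightarrow> h k = 0"
    unfolding h_def using gp gK by (auto intro: finite_combination_scale g)
  show ?case
  proof (cases "m = p")
    case True
    then show ?thesis using h insert.hyps by (intro exI[of _ h]) auto
  next
    case False
    then have "m \<in> K" using insert.prems by simp
    have "finite_combination T z (\<lambda>k. f m k + (- f m p) * h k)"
      using h f \<open>m \<in> K\<close> by (intro finite_combination_add finite_combination_scale) auto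
    then show ?thesis using h f insert.hyps False \<open>m \<in> K\<close>
      by (intro exI[of _ "\<lambda>k. f m k + (- f m p) * h k"]) auto
  qed
qed simp

text \<open>All unit vectors have to be produced by one common finite set of times, so the separate
  sets are united and the coefficients padded with 0.\<close>

lemma dual_coefficients_if_no_annihilator:
  fixes z :: "'t \<Rightarrow> 'k \<Rightarrow> real"
  assumes "finite K"
    and "\<And>l. \<forall>t\<in>T. (\<Sum>k\<in>K. l k * z t k) = 0 \<Longrightarrow> \<forall>k\<in>K. l k = 0"
  shows "\<exists>F c. finite F \<and> F \<subseteq> T \<and>
    (\<forall>k\<in>K. \<forall>m\<in>K. (\<Sum>t\<in>F. c m t * z t k) = of_bool (k = m))"
proof -
  have "\<forall>m\<in>K. \<exists>F c. finite F \<and> F \<subseteq> T \<and> (\<forall>k\<in>K. (\<Sum>t\<in>F. c t * z t k) = of_bool (k = m))"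
  proof
    fix m assume "m \<in> K"
    have "\<exists>f. finite_combination T z f \<and> (\<forall>k\<in>K. f k = of_bool (k = m))"
      by (rule unit_vectors_if_no_annihilator[OF assms \<open>m \<in> K\<close>])
    then show "\<exists>F c. finite F \<and> F \<subseteq> T \<and> (\<forall>k\<in>K. (\<Sum>t\<in>F. c t * z t k) = of_bool (k = m))"
      unfolding finite_combination_def by blast
  qed
  then obtain F c where F: "\<And>m. m \<in> K \<Longrightarrow> finite (F m) \<and> F m \<subseteq> T"
    "\<And>m k. m \<in> K \<Longrightarrow> k \<in> K \<Longrightarrow> (\<Sum>t\<in>F m. c m t * z t k) = of_bool (k = m)"
    by metis
  show ?thesis
  proof (intro exI[of _ "\<Union>m\<in>K. F m"] exI[of _ "\<lambda>m t. if t \<in> F m then c m t else 0"] conjI ballI)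
    fix k m assume km: "k \<in> K" "m \<in> K"
    have "(\<Sum>t\<in>(\<Union>m\<in>K. F m). (if t \<in> F m then c m t else 0) * z t k) = (\<Sum>t\<in>F m. c m t * z t k)"
      using F(1) km \<open>finite K\<close> by (intro sum.mono_neutral_cong_right) auto
    then show "(\<Sum>t\<in>(\<Union>m\<in>K. F m). (if t \<in> F m then c m t else 0) * z t k) = of_bool (k = m)"
      using F(2) km by simp
  qed (use F \<open>finite K\<close> in auto)
qed

section \<open>A cubic field with explicit flow\<close>

lemma has_derivative_powr_const:
  fixes f :: "'a::real_normed_vector \<Rightarrow> real"
  assumes "(f has_derivative f') (at x within S)" "f x > 0"
  shows "((\<lambda>x. f x powr r) has_derivative (\<lambda>v. f' v * (r * f x powr (r - 1)))) (at x within S)"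
  by (rule DERIV_compose_FDERIV[OF has_real_derivative_powr[OF assms(2)] assms(1)])

text \<open>The condition \<open>\<alpha> b + \<alpha> (\<iota> b) = 1\<close> makes \<open>x\<^sub>b x\<^bsub>\<iota> b\<^esub>\<close>, and hence the form \<open>q\<close> below, an eigenfunction of
  \<open>\<Sum>b. \<alpha> b x\<^sub>b \<partial>\<^sub>b\<close> with eigenvalue one.\<close>

locale cubic_system =
  fixes \<alpha> :: "'a::euclidean_space \<Rightarrow> real" and \<iota> :: "'a \<Rightarrow> 'a"
  assumes inj_\<alpha>: "inj_on \<alpha> Basis"
    and \<alpha>_pos: "b \<in> Basis \<Longrightarrow> 0 < \<alpha> b"
    and \<iota>_Basis: "b \<in> Basis \<Longrightarrow> \<iota> b \<in> Basis"
    and \<iota>_\<iota>: "b \<in> Basis \<Longrightarrow> \<iota> (\<iota> b) = b"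
    and \<alpha>_\<iota>: "b \<in> Basis \<Longrightarrow> \<alpha> b + \<alpha> (\<iota> b) = 1"
begin

lemma \<alpha>_less_1: "b \<in> Basis \<Longrightarrow> \<alpha> b < 1"
  using \<alpha>_\<iota>[of b] \<alpha>_pos[OF \<iota>_Basis, of b] by simp

lemma sum_\<iota>: "(\<Sum>b\<in>Basis. f (\<iota> b)) = (\<Sum>b\<in>Basis. f b)"
  by (rule sum.reindex_bij_witness[of _ \<iota> \<iota>]) (auto simp: \<iota>_Basis \<iota>_\<iota>)

definition q :: "'a \<Rightarrow> real" where
  "q x = (\<Sum>b\<in>Basis. (x \<bullet> b) * (x \<bullet> \<iota> b))"

text \<open>The symmetric bilinear form belonging to \<open>q\<close>; the derivative of
  \<open>q\<close> is twice this form.\<close>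

definition polar :: "'a \<Rightarrow> 'a \<Rightarrow> real" where
  "polar x v = (\<Sum>b\<in>Basis. (x \<bullet> \<iota> b) * (v \<bullet> b))"

definition Y :: "'a \<Rightarrow> 'a" where
  "Y x = (\<Sum>b\<in>Basis. (q x * \<alpha> b * (x \<bullet> b)) *\<^sub>R b)"

text \<open>Along \<open>Y\<close> the equation \<open>q' = q\<^sup>2\<close> gives
  \<open>q x / (1 - t * q x)\<close>, and then each coordinate solves a scalar linear equation, with
  the power as its solution. The formula is meant for \<open>t * q x < 1\<close>.\<close>

definition \<phi> :: "real \<Rightarrow> 'a \<Rightarrow> 'a" where
  "\<phi> t x = (\<Sum>b\<in>Basis. ((x \<bullet> b) * (1 - t * q x) powr (- \<alpha> b)) *\<^sub>R b)"

definition D\<phi> :: "real \<Rightarrow> 'a \<Rightarrow> 'a \<Rightarrow> 'a" where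
  "D\<phi> t x v = (\<Sum>b\<in>Basis. ((v \<bullet> b) * (1 - t * q x) powr (- \<alpha> b)
     + (x \<bullet> b) * (2 * t * \<alpha> b * polar x v * (1 - t * q x) powr (- \<alpha> b - 1))) *\<^sub>R b)"

text \<open>The quadratic coefficient is positive and the same for all \<open>x\<close>:
  translations make any \<open>q\<close> positive, and in the difference of two such values the
  quadratic terms cancel.\<close>

lemma q_add_One: "q (x + r *\<^sub>R One) = q x + 2 * r * (x \<bullet> One) + r\<^sup>2 * DIM('a)"
proof -
  have "q (x + r *\<^sub>R One) = (\<Sum>b\<in>Basis. (x \<bullet> b) * (x \<bullet> \<iota> b) + r * (x \<bullet> b) + r * (x \<bullet> \<iota> b) + r\<^sup>2)"
    unfolding q_def
    by (intro sum.cong) (auto simp: \<iota>_Basis inner_add_left algebra_simps power2_eq_square)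
  also have "\<dots> = q x + 2 * r * (x \<bullet> One) + r\<^sup>2 * DIM('a)"
    using sum_\<iota>[of "\<lambda>b. r * (x \<bullet> b)"]
    by (simp add: sum.distrib q_def inner_sum_right sum_distrib_left mult.assoc)
  finally show ?thesis .
qed

lemma q_has_derivative: "(q has_derivative (\<lambda>v. 2 * polar x v)) (at x within S)"
proof -
  have "(q has_derivative (\<lambda>v. \<Sum>b\<in>Basis. (x \<bullet> b) * (v \<bullet> \<iota> b) + (v \<bullet> b) * (x \<bullet> \<iota> b))) (at x within S)"
    unfolding q_def[abs_def] by (auto intro!: derivative_eq_intros)
  moreover have "(\<Sum>b\<in>Basis. (x \<bullet> b) * (v \<bullet> \<iota> b) + (v \<bullet> b) * (x \<bullet> \<iota> b)) = 2 * polar x v" for v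
    using sum_\<iota>[of "\<lambda>b. (x \<bullet> \<iota> b) * (v \<bullet> b)"]
    by (simp add: polar_def sum.distrib \<iota>_\<iota> mult.commute)
  ultimately show ?thesis by simp
qed

lemma q_isCont: "isCont q x"
  using q_has_derivative has_derivative_continuous by blast

lemma open_flow_domain: "open {x. t * q x < 1}"
  by (intro open_Collect_less continuous_intros continuous_at_imp_continuous_on ballI q_isCont)

lemma \<phi>_inner: "b \<in> Basis \<Longrightarrow> \<phi> t x \<bullet> b = (x \<bullet> b) * (1 - t * q x) powr (- \<alpha> b)"
  by (simp add: \<phi>_def)

lemma \<phi>_0 [simp]: "\<phi> 0 x = x"
  by (simp add: \<phi>_def euclidean_representation)

text \<open>Each product of paired coordinates acquires the exponent
  \<open>- \<alpha> b - \<alpha> (\<iota> b) = - 1\<close>.\<close>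

lemma q_\<phi>:
  assumes "t * q x < 1"
  shows "q (\<phi> t x) = q x / (1 - t * q x)"
proof -
  have "(\<phi> t x \<bullet> b) * (\<phi> t x \<bullet> \<iota> b) = (x \<bullet> b) * (x \<bullet> \<iota> b) / (1 - t * q x)" if b: "b \<in> Basis" for b
  proof -
    have "(1 - t * q x) powr (- \<alpha> b) * (1 - t * q x) powr (- \<alpha> (\<iota> b)) = (1 - t * q x) powr (-1)"
    proof -
      have "- \<alpha> b + - \<alpha> (\<iota> b) = -1" using \<alpha>_\<iota>[OF b] by simp
      then show ?thesis by (simp only: powr_add[symmetric])
    qed
    also have "\<dots> = 1 / (1 - t * q x)" using assms by (simp add: powr_minus_divide)
    finally show ?thesis by (simp add: \<phi>_inner b \<iota>_Basis mult.assoc mult.left_commute)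
  qed
  then show ?thesis by (simp add: q_def sum_divide_distrib)
qed

lemma one_plus_q_\<phi>:
  assumes "t * q x < 1"
  shows "1 + t * q (\<phi> t x) = 1 / (1 - t * q x)"
  using assms by (simp add: q_\<phi> field_simps)

lemma \<phi>_domain_inverse: "t * q x < 1 \<Longrightarrow> - t * q (\<phi> t x) < 1"
  using one_plus_q_\<phi>[of t x] by (simp add: pos_divide_less_eq) (smt (verit) divide_pos_pos)

lemma \<phi>_inverse:
  assumes "t * q x < 1"
  shows "\<phi> (- t) (\<phi> t x) = x"
proof (rule euclidean_eqI)
  fix b :: 'a assume b: "b \<in> Basis"
  have "\<phi> (- t) (\<phi> t x) \<bullet> b = (x \<bullet> b) * ((1 - t * q x) powr (- \<alpha> b) * (1 / (1 - t * q x)) powr (- \<alpha> b))"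
    using b one_plus_q_\<phi>[OF assms] by (simp add: \<phi>_inner)
  also have "(1 - t * q x) powr (- \<alpha> b) * (1 / (1 - t * q x)) powr (- \<alpha> b) = 1"
    using assms by (simp flip: powr_mult)
  finally show "\<phi> (- t) (\<phi> t x) \<bullet> b = x \<bullet> b" by simp
qed

lemma \<phi>_has_derivative:
  assumes "t * q x < 1"
  shows "(\<phi> t has_derivative D\<phi> t x) (at x)"
proof -
  have *: "((\<lambda>x. 1 - t * q x) has_derivative (\<lambda>v. - (t * (2 * polar x v)))) (at x)"
    by (rule derivative_eq_intros q_has_derivative refl)+ simp
  have "((\<lambda>x. (1 - t * q x) powr (- \<alpha> b)) has_derivative
      (\<lambda>v. - (t * (2 * polar x v)) * (- \<alpha> b * (1 - t * q x) powr (- \<alpha> b - 1)))) (at x)" for b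
    by (rule has_derivative_powr_const[OF *]) (use assms in simp)
  note [derivative_intros] = this
  show ?thesis unfolding \<phi>_def[abs_def] D\<phi>_def[abs_def]
    by (rule derivative_eq_intros refl)+ (auto intro!: ext sum.cong simp: algebra_simps)
qed

lemma D\<phi>_isCont:
  assumes "t * q x < 1"
  shows "isCont (\<lambda>y. D\<phi> t y v) x"
proof -
  have "isCont (\<lambda>y. polar y v) x" unfolding polar_def by (intro continuous_intros)
  then show ?thesis unfolding D\<phi>_def using assms
    by (intro continuous_intros q_isCont) auto
qed

lemma \<phi>_has_strict_derivative:
  assumes "t * q x < 1"
  shows "has_strict_derivative (\<phi> t) (D\<phi> t x) x"
  by (rule C1_imp_has_strict_derivative[OF open_flow_domain[of t]])
     (use assms in \<open>auto intro: \<phi>_has_derivative D\<phi>_isCont\<close>)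

text \<open>Differentiates \<open>\<phi>_inverse\<close>, which holds on the open flow
  domain.\<close>

lemma D\<phi>_inverse:
  assumes "t * q x < 1"
  shows "D\<phi> (- t) (\<phi> t x) (D\<phi> t x v) = v"
proof -
  have "((\<lambda>y. \<phi> (- t) (\<phi> t y)) has_derivative (\<lambda>v. D\<phi> (- t) (\<phi> t x) (D\<phi> t x v))) (at x)"
    by (rule has_derivative_compose[OF \<phi>_has_derivative[OF assms]
          \<phi>_has_derivative[OF \<phi>_domain_inverse[OF assms]]])
  moreover have "((\<lambda>y. \<phi> (- t) (\<phi> t y)) has_derivative (\<lambda>v. v)) (at x)"
    by (rule has_derivative_transform_within_open[OF has_derivative_ident open_flow_domain[of t]])
       (use assms \<phi>_inverse in auto)
  ultimately show ?thesis by (metis has_derivative_unique)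
qed

lemma \<phi>_has_vector_derivative:
  assumes "t * q x < 1"
  shows "((\<lambda>t. \<phi> t x) has_vector_derivative Y (\<phi> t x)) (at t)"
proof -
  have "((\<lambda>t. (x \<bullet> b) * (1 - t * q x) powr (- \<alpha> b)) has_real_derivative
      q (\<phi> t x) * \<alpha> b * (\<phi> t x \<bullet> b)) (at t)" if "b \<in> Basis" for b
  proof -
    have "((\<lambda>t. (x \<bullet> b) * (1 - t * q x) powr (- \<alpha> b)) has_real_derivative
        (x \<bullet> b) * (\<alpha> b * q x * (1 - t * q x) powr (- \<alpha> b - 1))) (at t)"
      using assms by (auto intro!: derivative_eq_intros)
    moreover have "(1 - t * q x) powr (- \<alpha> b - 1) = (1 - t * q x) powr (- \<alpha> b) / (1 - t * q x)"
      using assms by (simp add: powr_diff)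
    ultimately show ?thesis using assms that by (simp add: q_\<phi> \<phi>_inner mult_ac)
  qed
  then have "((\<lambda>t. \<Sum>b\<in>Basis. ((x \<bullet> b) * (1 - t * q x) powr (- \<alpha> b)) *\<^sub>R b) has_vector_derivative
      (\<Sum>b\<in>Basis. (q (\<phi> t x) * \<alpha> b * (\<phi> t x \<bullet> b)) *\<^sub>R b)) (at t)"
    by (intro has_vector_derivative_sum
        has_vector_derivative_eq_rhs[OF has_vector_derivative_scaleR[OF _ has_vector_derivative_const]]) auto
  then show ?thesis by (simp add: Y_def \<phi>_def[abs_def])
qed

text \<open>The pullback of the constant field \<^term>\<open>One\<close> by the time-\<open>t\<close> flow of \<^term>\<open>Y\<close>.\<close>

definition Z :: "real \<Rightarrow> 'a \<Rightarrow> 'a" where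
  "Z t x = D\<phi> (- t) (\<phi> t x) One"

text \<open>At the point \<open>\<phi> t x\<close> the inverse flow has base \<open>1 / s\<close>
  with \<open>s = 1 - t * q x\<close>, so all exponents turn positive; the pairing by
  \<open>\<iota>\<close> converts \<open>s * s powr (- \<alpha> (\<iota> c))\<close> into
  \<open>s powr \<alpha> c\<close>. The result is a combination of the powers
  \<open>s powr \<alpha> c\<close> with coefficients affine in \<open>t\<close>, the shape that
  \<open>powr_sum_independent\<close> handles.\<close>

lemma Z_inner:
  assumes t: "t * q x < 1" and b: "b \<in> Basis"
  shows "Z t x \<bullet> b = (1 - t * q x) powr \<alpha> b
    - 2 * t * \<alpha> b * (x \<bullet> b) * (\<Sum>c\<in>Basis. (x \<bullet> \<iota> c) * (1 - t * q x) powr \<alpha> c)"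
proof -
  define s where "s = 1 - t * q x"
  have s: "s > 0" using t by (simp add: s_def)
  have inv: "1 + t * q (\<phi> t x) = 1 / s" using one_plus_q_\<phi>[OF t] by (simp add: s_def)
  have inv_powr: "(1 / s) powr (- r) = s powr r" for r
    using s by (simp add: powr_divide powr_minus_divide)
  have "polar (\<phi> t x) One = (\<Sum>c\<in>Basis. (x \<bullet> \<iota> c) * s powr (- \<alpha> (\<iota> c)))"
    by (simp add: polar_def \<phi>_inner \<iota>_Basis s_def)
  then have "s * polar (\<phi> t x) One = (\<Sum>c\<in>Basis. (x \<bullet> \<iota> c) * (s * s powr (- \<alpha> (\<iota> c))))"
    by (simp add: sum_distrib_left mult.left_commute)
  also have "\<dots> = (\<Sum>c\<in>Basis. (x \<bullet> \<iota> c) * s powr \<alpha> c)"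
  proof (rule sum.cong[OF refl])
    fix c :: 'a assume "c \<in> Basis"
    then have "\<alpha> c = 1 + - \<alpha> (\<iota> c)" using \<alpha>_\<iota> by force
    then have "s powr \<alpha> c = s * s powr (- \<alpha> (\<iota> c))" using s by (simp only: powr_add powr_one)
    then show "(x \<bullet> \<iota> c) * (s * s powr (- \<alpha> (\<iota> c))) = (x \<bullet> \<iota> c) * s powr \<alpha> c" by simp
  qed
  finally have polar: "s * polar (\<phi> t x) One = (\<Sum>c\<in>Basis. (x \<bullet> \<iota> c) * s powr \<alpha> c)" .
  have "Z t x \<bullet> b = (1 / s) powr (- \<alpha> b)
      + (\<phi> t x \<bullet> b) * (2 * (- t) * \<alpha> b * polar (\<phi> t x) One * (1 / s) powr (- \<alpha> b - 1))"
    using b inv by (simp add: Z_def D\<phi>_def)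
  also have "(1 / s) powr (- \<alpha> b - 1) = s powr \<alpha> b * s"
    using s inv_powr[of "\<alpha> b + 1"] by (simp add: powr_add)
  also have "\<phi> t x \<bullet> b = (x \<bullet> b) * s powr (- \<alpha> b)" using b by (simp add: \<phi>_inner s_def)
  also have "(x \<bullet> b) * s powr (- \<alpha> b) * (2 * (- t) * \<alpha> b * polar (\<phi> t x) One * (s powr \<alpha> b * s))
      = - (2 * t * \<alpha> b * (x \<bullet> b) * (s * polar (\<phi> t x) One)) * (s powr (- \<alpha> b) * s powr \<alpha> b)"
    by (simp add: mult_ac)
  also have "s powr (- \<alpha> b) * s powr \<alpha> b = 1" using s by (simp flip: powr_add)
  finally show ?thesis unfolding inv_powr polar by (simp add: s_def)
qed

text \<open>One simultaneous move of all points. Only indices in \<open>I\<close> are constrained,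
  so tuples agreeing on \<open>I\<close> are interchangeable, and the domain condition ensures that
  the local flow is defined at each point.\<close>

definition step :: "nat set \<Rightarrow> (nat \<Rightarrow> 'a) \<Rightarrow> (nat \<Rightarrow> 'a) \<Rightarrow> bool" where
  "step I x y \<longleftrightarrow> (\<exists>s. \<forall>i\<in>I. y i = x i + s *\<^sub>R One) \<or> (\<exists>t. \<forall>i\<in>I. t * q (x i) < 1 \<and> y i = \<phi> t (x i))"

abbreviation reach :: "nat set \<Rightarrow> (nat \<Rightarrow> 'a) \<Rightarrow> (nat \<Rightarrow> 'a) \<Rightarrow> bool" where
  "reach I \<equiv> (step I)\<^sup>*\<^sup>*"

lemma step_translate: "(\<And>i. i \<in> I \<Longrightarrow> y i = x i + s *\<^sub>R One) \<Longrightarrow> step I x y"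
  unfolding step_def by blast

lemma step_\<phi>: "(\<And>i. i \<in> I \<Longrightarrow> t * q (x i) < 1 \<and> y i = \<phi> t (x i)) \<Longrightarrow> step I x y"
  unfolding step_def by blast

lemma step_eq_on: "(\<And>i. i \<in> I \<Longrightarrow> y i = x i) \<Longrightarrow> step I x y"
  by (rule step_translate[where s = 0]) auto

lemma step_sym:
  assumes "step I x y"
  shows "step I y x"
  using assms unfolding step_def
proof (elim disjE exE)
  fix s assume "\<forall>i\<in>I. y i = x i + s *\<^sub>R One"
  then have "\<forall>i\<in>I. x i = y i + (- s) *\<^sub>R One" by simp
  then show "(\<exists>s. \<forall>i\<in>I. x i = y i + s *\<^sub>R One) \<or> (\<exists>t. \<forall>i\<in>I. t * q (y i) < 1 \<and> x i = \<phi> t (y i))"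
    by blast
next
  fix t assume "\<forall>i\<in>I. t * q (x i) < 1 \<and> y i = \<phi> t (x i)"
  then have "\<forall>i\<in>I. - t * q (y i) < 1 \<and> x i = \<phi> (- t) (y i)"
    using \<phi>_inverse \<phi>_domain_inverse by metis
  then show "(\<exists>s. \<forall>i\<in>I. x i = y i + s *\<^sub>R One) \<or> (\<exists>t. \<forall>i\<in>I. t * q (y i) < 1 \<and> x i = \<phi> t (y i))"
    by blast
qed

lemma reach_sym: "reach I x y \<Longrightarrow> reach I y x"
  by (induction rule: rtranclp_induct) (auto intro: converse_rtranclp_into_rtranclp step_sym)

definition open_orbit :: "nat set \<Rightarrow> (nat \<Rightarrow> 'a) \<Rightarrow> bool" where
  "open_orbit I x \<longleftrightarrow> (\<exists>\<epsilon>>0. \<forall>y. (\<forall>i\<in>I. dist (y i) (x i) < \<epsilon>) \<longrightarrow> reach I x y)"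

text \<open>Apply the move from \<open>x\<close> to \<open>x'\<close> to a nearby \<open>y\<close>
  as well. By continuity and openness of the flow domain it is defined there and ends at some
  \<open>y'\<close> near \<open>x'\<close>; the path goes from \<open>x\<close> to
  \<open>x'\<close>, on to \<open>y'\<close>, and back to \<open>y\<close> by the reversed
  move.\<close>

lemma open_orbit_step:
  assumes "finite I" "step I x x'" "open_orbit I x'"
  shows "open_orbit I x"
proof -
  obtain \<epsilon> where "\<epsilon> > 0" and \<epsilon>: "\<And>y. (\<forall>i\<in>I. dist (y i) (x' i) < \<epsilon>) \<Longrightarrow> reach I x' y"
    using assms(3) unfolding open_orbit_def by blast
  have *: "reach I x y" if "step I y y'" "\<forall>i\<in>I. dist (y' i) (x' i) < \<epsilon>" for y y'
    using assms(2) \<epsilon>[OF that(2)] step_sym[OF that(1)]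
    by (meson converse_rtranclp_into_rtranclp rtranclp.rtrancl_into_rtrancl)
  show ?thesis using assms(2) unfolding step_def
  proof (elim disjE exE)
    fix s assume "\<forall>i\<in>I. x' i = x i + s *\<^sub>R One"
    then have "reach I x y" if "\<forall>i\<in>I. dist (y i) (x i) < \<epsilon>" for y
      using that by (intro *[of y "\<lambda>i. y i + s *\<^sub>R One"] step_translate[where s = s]) auto
    then show ?thesis unfolding open_orbit_def using \<open>\<epsilon> > 0\<close> by blast
  next
    fix t assume t: "\<forall>i\<in>I. t * q (x i) < 1 \<and> x' i = \<phi> t (x i)"
    have "\<forall>i\<in>I. \<exists>\<delta>>0. \<forall>y. dist y (x i) < \<delta> \<longrightarrow> t * q y < 1 \<and> dist (\<phi> t y) (x' i) < \<epsilon>"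
    proof
      fix i assume "i \<in> I"
      with t have i: "t * q (x i) < 1" "x' i = \<phi> t (x i)" by auto
      have "isCont (\<phi> t) (x i)"
        by (rule has_strict_derivative_isCont[OF \<phi>_has_strict_derivative[OF i(1)]])
      then have "(\<phi> t \<longlongrightarrow> \<phi> t (x i)) (nhds (x i))"
        by (simp add: isCont_def tendsto_at_iff_tendsto_nhds)
      then have "\<forall>\<^sub>F y in nhds (x i). dist (\<phi> t y) (x' i) < \<epsilon>"
        using \<open>\<epsilon> > 0\<close> i(2) by (simp add: tendstoD)
      moreover have "\<forall>\<^sub>F y in nhds (x i). y \<in> {y. t * q y < 1}"
        using i(1) by (intro eventually_nhds_in_open open_flow_domain) auto
      ultimately have "\<forall>\<^sub>F y in nhds (x i). t * q y < 1 \<and> dist (\<phi> t y) (x' i) < \<epsilon>"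
        by eventually_elim simp
      then show "\<exists>\<delta>>0. \<forall>y. dist y (x i) < \<delta> \<longrightarrow> t * q y < 1 \<and> dist (\<phi> t y) (x' i) < \<epsilon>"
        by (simp add: eventually_nhds_metric)
    qed
    then obtain \<delta> where \<delta>: "\<And>i. i \<in> I \<Longrightarrow> \<delta> i > 0"
      "\<And>i y. i \<in> I \<Longrightarrow> dist y (x i) < \<delta> i \<Longrightarrow> t * q y < 1 \<and> dist (\<phi> t y) (x' i) < \<epsilon>"
      by metis
    \<comment> \<open>The inserted 1 keeps the minimum meaningful for empty
      \<open>I\<close>.\<close>
    have "reach I x y" if "\<forall>i\<in>I. dist (y i) (x i) < Min (insert 1 (\<delta> ` I))" for y
      using that \<open>finite I\<close> \<delta>(2)
      by (intro *[of y "\<lambda>i. \<phi> t (y i)"] step_\<phi>[where t = t]) auto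
    moreover have "Min (insert 1 (\<delta> ` I)) > 0" using \<delta>(1) \<open>finite I\<close> by auto
    ultimately show ?thesis unfolding open_orbit_def by blast
  qed
qed

lemma open_orbit_reach:
  assumes "finite I" "reach I x x'" "open_orbit I x'"
  shows "open_orbit I x"
  using assms(2) assms(3)
  by (induction rule: converse_rtranclp_induct) (auto intro: open_orbit_step[OF \<open>finite I\<close>])

end

section \<open>Orbits are open\<close>

context cubic_system begin

section \<open>Moving a tuple of distinct points into general position\<close>

lemma q_add_One_eventually_pos: "\<forall>\<^sub>F r in at_top. q (x + r *\<^sub>R One) > 0"
  \<comment> \<open>Above this threshold \<open>r\<^sup>2\<close> exceeds \<open>r\<close> times the
    threshold and so dominates both the linear term and \<open>q x\<close>.\<close>
  using eventually_gt_at_top[of "1 + 2 * \<bar>x \<bullet> One\<bar> + \<bar>q x\<bar>"]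
proof eventually_elim
  case (elim r)
  then have r: "r > 1" by linarith
  have "r * (1 + 2 * \<bar>x \<bullet> One\<bar> + \<bar>q x\<bar>) < r * r" using elim r by (intro mult_strict_left_mono) auto
  moreover have "r * r \<le> r\<^sup>2 * DIM('a)"
    using mult_left_mono[of 1 "real DIM('a)" "r\<^sup>2"] DIM_positive[where 'a = 'a]
    by (simp add: power2_eq_square Suc_le_eq)
  moreover have "\<bar>q x\<bar> \<le> r * \<bar>q x\<bar>" using r by (simp add: mult_le_cancel_right1)
  moreover have "- (r * \<bar>x \<bullet> One\<bar>) \<le> r * (x \<bullet> One)"
    using mult_left_mono[of "- \<bar>x \<bullet> One\<bar>" "x \<bullet> One" r] r by simp
  ultimately show ?case using r unfolding q_add_One by (simp add: distrib_left)
qed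

text \<open>The difference of the two values is affine in \<open>r\<close>, and by assumption it is
  not identically zero.\<close>

lemma q_add_One_eventually_neq:
  assumes "q x \<noteq> q y \<or> x \<bullet> One \<noteq> y \<bullet> One"
  shows "\<forall>\<^sub>F r in at_top. q (x + r *\<^sub>R One) \<noteq> q (y + r *\<^sub>R One)"
proof (cases "x \<bullet> One = y \<bullet> One")
  case True
  then show ?thesis using assms by (simp add: q_add_One)
next
  case False
  then have o: "x \<bullet> One - y \<bullet> One \<noteq> 0" by simp
  show ?thesis
    using eventually_gt_at_top[of "(q y - q x) / (2 * (x \<bullet> One - y \<bullet> One))"]
  proof eventually_elim
    case (elim r)
    have "q (x + r *\<^sub>R One) - q (y + r *\<^sub>R One)
        = 2 * (x \<bullet> One - y \<bullet> One) * r - (q y - q x)"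
      unfolding q_add_One by (simp add: algebra_simps)
    moreover have "(q y - q x) / (2 * (x \<bullet> One - y \<bullet> One)) \<noteq> r" using elim by simp
    then have "2 * (x \<bullet> One - y \<bullet> One) * r - (q y - q x) \<noteq> 0"
      using o by (auto simp: field_simps)
    ultimately show ?case by auto
  qed
qed

text \<open>Different values of \<open>q\<close> stay different under the flow. If they agree, the
  flow scales coordinate \<open>b\<close> of both points by the same factor
  \<open>u powr \<alpha> b\<close>, where \<open>u\<close> tends to 0 from the right as
  \<open>t\<close> goes to minus infinity. The difference of the coordinate sums is then a
  nontrivial combination of distinct powers of \<open>u\<close>, eventually nonzero.\<close>

lemma \<phi>_eventually_separates:
  assumes "x \<noteq> y" "q x > 0" "q y > 0"
  shows "\<forall>\<^sub>F t in at_bot. q (\<phi> t x) \<noteq> q (\<phi> t y) \<or> \<phi> t x \<bullet> One \<noteq> \<phi> t y \<bullet> One"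
proof (cases "q x = q y")
  case False
  show ?thesis using eventually_gt_at_bot[of 0]
  proof eventually_elim
    case (elim t)
    then have "t * q x < 0" "t * q y < 0" using assms by (auto simp: mult_less_0_iff)
    then show ?case using False by (simp add: q_\<phi> field_simps)
  qed
next
  case True
  obtain b where b: "b \<in> Basis" "(x - y) \<bullet> b \<noteq> 0"
    using assms(1) by (auto simp: euclidean_eq_iff[of x y] inner_diff_left)
  have "\<not> (\<exists>\<^sub>F u in at_right 0. \<bar>\<Sum>b\<in>Basis. ((x - y) \<bullet> b) * u powr \<alpha> b\<bar> \<le> 0 * u powr 1)"
    using powr_sum_dominated_imp_zero[OF finite_Basis inj_\<alpha> \<alpha>_less_1 _ b(1),
        of "\<lambda>b. (x - y) \<bullet> b" 0] b(2) by blast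
  then have "\<forall>\<^sub>F u in at_right 0. (\<Sum>b\<in>Basis. ((x - y) \<bullet> b) * u powr \<alpha> b) \<noteq> 0"
    by (simp add: not_frequently)
  moreover have "filterlim (\<lambda>t. 1 / (1 - t * q x)) (at_right 0) at_bot"
  proof -
    have "filterlim (\<lambda>t::real. - t) at_top at_bot" by (rule filterlim_uminus_at_top_at_bot)
    then have "filterlim (\<lambda>t. q x * (- t)) at_top at_bot"
      by (rule filterlim_tendsto_pos_mult_at_top[OF tendsto_const assms(2)])
    then have "filterlim (\<lambda>t. 1 + q x * (- t)) at_top at_bot"
      by (rule filterlim_tendsto_add_at_top[OF tendsto_const])
    then have "filterlim (\<lambda>t. inverse (1 + q x * (- t))) (at_right 0) at_bot"
      by (rule filterlim_compose[OF filterlim_inverse_at_right_top])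
    then show ?thesis by (simp add: inverse_eq_divide mult.commute)
  qed
  ultimately have "\<forall>\<^sub>F t in at_bot. (\<Sum>b\<in>Basis. ((x - y) \<bullet> b) * (1 / (1 - t * q x)) powr \<alpha> b) \<noteq> 0"
    by (rule eventually_compose_filterlim)
  then show ?thesis using eventually_gt_at_bot[of 0]
  proof eventually_elim
    case (elim t)
    have "t * q x < 1" using mult_neg_pos[OF elim(2) assms(2)] by simp
    have "\<phi> t x \<bullet> One - \<phi> t y \<bullet> One = (\<Sum>b\<in>Basis. ((x - y) \<bullet> b) * (1 - t * q x) powr (- \<alpha> b))"
      by (simp add: inner_sum_right \<phi>_inner True inner_diff_left left_diff_distrib sum_subtractf)
    also have "\<dots> = (\<Sum>b\<in>Basis. ((x - y) \<bullet> b) * (1 / (1 - t * q x)) powr \<alpha> b)"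
      using \<open>t * q x < 1\<close> by (intro sum.cong) (auto simp: powr_divide powr_minus_divide)
    finally show ?case using elim by auto
  qed
qed

text \<open>Translation cannot separate the \<open>q\<close> values of two points with the same
  \<open>q\<close> and the same coordinate sum. So positivity is arranged first, which admits all
  negative flow times; flowing backwards breaks such coincidences, and a second translation turns
  the result into distinct positive values of \<open>q\<close>.\<close>

lemma reach_generic_position:
  assumes "finite I" "inj_on x I"
  obtains x' where "reach I x x'" "\<And>i. i \<in> I \<Longrightarrow> q (x' i) > 0" "inj_on (\<lambda>i. q (x' i)) I"
proof -
  have "\<forall>\<^sub>F r in at_top. \<forall>i\<in>I. q (x i + r *\<^sub>R One) > 0"
    using assms(1) by (intro eventually_ball_finite ballI q_add_One_eventually_pos)
  from eventually_happens'[OF trivial_limit_at_top_linorder this]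
  obtain r where r: "\<And>i. i \<in> I \<Longrightarrow> q (x i + r *\<^sub>R One) > 0" by blast
  define x1 where "x1 i = x i + r *\<^sub>R One" for i
  define P where "P = {p \<in> I \<times> I. fst p \<noteq> snd p}"
  have "finite P" using assms(1) by (simp add: P_def)
  define sep where "sep t p \<longleftrightarrow> q (\<phi> t (x1 (fst p))) \<noteq> q (\<phi> t (x1 (snd p)))
      \<or> \<phi> t (x1 (fst p)) \<bullet> One \<noteq> \<phi> t (x1 (snd p)) \<bullet> One" for t p
  have "\<forall>\<^sub>F t in at_bot. \<forall>p\<in>P. sep t p"
  proof (intro eventually_ball_finite \<open>finite P\<close> ballI)
    fix p assume "p \<in> P"
    then have p: "fst p \<in> I" "snd p \<in> I" "fst p \<noteq> snd p" by (simp_all add: P_def mem_Times_iff)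
    then have "x1 (fst p) \<noteq> x1 (snd p)"
      using assms(2) by (simp add: x1_def inj_on_eq_iff)
    then show "\<forall>\<^sub>F t in at_bot. sep t p"
      unfolding sep_def using r p(1,2) by (intro \<phi>_eventually_separates) (simp_all add: x1_def)
  qed
  then have "\<forall>\<^sub>F t in at_bot. t < 0 \<and> (\<forall>p\<in>P. sep t p)"
    using eventually_gt_at_bot[of 0] by eventually_elim simp
  from eventually_happens'[OF trivial_limit_at_bot_linorder this]
  obtain t where "t < 0" and t: "\<And>p. p \<in> P \<Longrightarrow> sep t p" by blast
  define x2 where "x2 i = \<phi> t (x1 i)" for i
  have "\<forall>\<^sub>F r in at_top. \<forall>p\<in>P. q (x2 (fst p) + r *\<^sub>R One) \<noteq> q (x2 (snd p) + r *\<^sub>R One)"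
    by (intro eventually_ball_finite \<open>finite P\<close> ballI q_add_One_eventually_neq t[unfolded sep_def, folded x2_def])
  moreover have "\<forall>\<^sub>F r in at_top. \<forall>i\<in>I. q (x2 i + r *\<^sub>R One) > 0"
    using assms(1) by (intro eventually_ball_finite ballI q_add_One_eventually_pos)
  ultimately have "\<forall>\<^sub>F r in at_top. (\<forall>p\<in>P. q (x2 (fst p) + r *\<^sub>R One) \<noteq> q (x2 (snd p) + r *\<^sub>R One))
      \<and> (\<forall>i\<in>I. q (x2 i + r *\<^sub>R One) > 0)" by (rule eventually_conj)
  from eventually_happens'[OF trivial_limit_at_top_linorder this]
  obtain r' where r': "\<And>p. p \<in> P \<Longrightarrow> q (x2 (fst p) + r' *\<^sub>R One) \<noteq> q (x2 (snd p) + r' *\<^sub>R One)"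
      "\<And>i. i \<in> I \<Longrightarrow> q (x2 i + r' *\<^sub>R One) > 0" by blast
  define x3 where "x3 i = x2 i + r' *\<^sub>R One" for i
  have s1: "step I x x1" by (rule step_translate) (simp add: x1_def)
  have s2: "step I x1 x2"
  proof (rule step_\<phi>)
    fix i assume "i \<in> I"
    then have "t * q (x1 i) < 0" using r \<open>t < 0\<close> by (simp add: x1_def mult_neg_pos)
    then show "t * q (x1 i) < 1 \<and> x2 i = \<phi> t (x1 i)" by (simp add: x2_def)
  qed
  have s3: "step I x2 x3" by (rule step_translate) (simp add: x3_def)
  have "reach I x x3"
    by (rule converse_rtranclp_into_rtranclp[OF s1 converse_rtranclp_into_rtranclp[OF s2
          r_into_rtranclp[of "step I", OF s3]]])
  moreover have "inj_on (\<lambda>i. q (x3 i)) I"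
  proof (rule inj_onI, rule ccontr)
    fix i k assume "i \<in> I" "k \<in> I" "q (x3 i) = q (x3 k)" "i \<noteq> k"
    then show False using r'(1)[of "(i, k)"] by (simp add: P_def x3_def)
  qed
  moreover have "q (x3 i) > 0" if "i \<in> I" for i using r'(2)[OF that] by (simp only: x3_def)
  ultimately show thesis by (intro that[of x3])
qed

text \<open>By \<open>Z_inner\<close>, the pairing with a covector is a sum of the type treated in
  \<open>powr_sum_independent\<close>, with \<open>\<beta> i = q (x i)\<close>.\<close>

lemma Z_no_annihilator:
  assumes "finite I" and pos: "\<And>i. i \<in> I \<Longrightarrow> q (x i) > 0" and inj: "inj_on (\<lambda>i. q (x i)) I"
    and l: "\<forall>t\<in>{t. \<forall>i\<in>I. t * q (x i) < 1}. (\<Sum>k\<in>I \<times> Basis. l k * (Z t (x (fst k)) \<bullet> snd k)) = 0"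
  shows "\<forall>k\<in>I \<times> Basis. l k = 0"
proof -
  \<comment> \<open>The coefficient of \<open>t * s powr \<alpha> c\<close> after the sums over
    \<open>b\<close> and \<open>c\<close> are exchanged.\<close>
  define B where "B i c = - 2 * (x i \<bullet> \<iota> c) * (\<Sum>b\<in>Basis. \<alpha> b * l (i, b) * (x i \<bullet> b))" for i c
  have eq: "(\<Sum>b\<in>Basis. l (i, b) * (Z t (x i) \<bullet> b))
      = (\<Sum>c\<in>Basis. (1 - q (x i) * t) powr \<alpha> c * (l (i, c) + t * B i c))"
    if "t * q (x i) < 1" for i t
  proof -
    define s where "s = 1 - t * q (x i)"
    have "(\<Sum>b\<in>Basis. l (i, b) * (Z t (x i) \<bullet> b))
      = (\<Sum>b\<in>Basis. l (i, b) * s powr \<alpha> b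
          - \<alpha> b * l (i, b) * (x i \<bullet> b) * (2 * t * (\<Sum>c\<in>Basis. (x i \<bullet> \<iota> c) * s powr \<alpha> c)))"
      using that by (intro sum.cong) (auto simp: Z_inner s_def algebra_simps)
    also have "\<dots> = (\<Sum>b\<in>Basis. l (i, b) * s powr \<alpha> b)
        - (\<Sum>b\<in>Basis. \<alpha> b * l (i, b) * (x i \<bullet> b)) * (2 * t * (\<Sum>c\<in>Basis. (x i \<bullet> \<iota> c) * s powr \<alpha> c))"
      by (simp only: sum_subtractf sum_distrib_right)
    also have "\<dots> = (\<Sum>c\<in>Basis. l (i, c) * s powr \<alpha> c
        - (\<Sum>b\<in>Basis. \<alpha> b * l (i, b) * (x i \<bullet> b)) * (2 * t * ((x i \<bullet> \<iota> c) * s powr \<alpha> c)))"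
      by (simp only: sum_subtractf sum_distrib_left)
    also have "\<dots> = (\<Sum>c\<in>Basis. s powr \<alpha> c * (l (i, c) + t * B i c))"
      by (intro sum.cong refl) (simp add: B_def algebra_simps)
    finally show ?thesis by (simp add: s_def mult.commute)
  qed
  \<comment> \<open>The sum bounds every single \<open>q (x i)\<close>; adding 1 keeps the
    denominator positive even for empty \<open>I\<close>.\<close>
  define \<epsilon> where "\<epsilon> = 1 / (1 + (\<Sum>i\<in>I. q (x i)))"
  have sum_nonneg: "0 \<le> (\<Sum>i\<in>I. q (x i))" using pos by (intro sum_nonneg) (simp add: less_imp_le)
  have small: "t * q (x i) < 1" if "i \<in> I" "0 < t" "t < \<epsilon>" for i t
  proof -
    have "t * q (x i) \<le> t * (\<Sum>i\<in>I. q (x i))"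
      using that pos \<open>finite I\<close> by (intro mult_left_mono member_le_sum) (auto simp: less_imp_le)
    also have "\<dots> < 1" using that(2,3) sum_nonneg by (simp add: \<epsilon>_def field_simps)
    finally show ?thesis .
  qed
  have "\<forall>i\<in>I. \<forall>c\<in>Basis. l (i, c) = 0 \<and> B i c = 0"
  proof (rule powr_sum_independent[OF \<open>finite I\<close> finite_Basis inj pos inj_\<alpha>])
    show "0 < \<alpha> c \<and> \<alpha> c < 1" if "c \<in> Basis" for c using that \<alpha>_pos \<alpha>_less_1 by simp
    show "0 < \<epsilon>" using sum_nonneg by (simp add: \<epsilon>_def)
    fix t assume t: "0 < t" "t < \<epsilon>"
    have "0 = (\<Sum>k\<in>I \<times> Basis. l k * (Z t (x (fst k)) \<bullet> snd k))"
      using l small t by simp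
    also have "\<dots> = (\<Sum>i\<in>I. \<Sum>b\<in>Basis. l (i, b) * (Z t (x i) \<bullet> b))"
      by (simp add: sum.cartesian_product case_prod_unfold)
    also have "\<dots> = (\<Sum>i\<in>I. \<Sum>c\<in>Basis. (1 - q (x i) * t) powr \<alpha> c * (l (i, c) + t * B i c))"
      using small t by (intro sum.cong eq) auto
    finally show "(\<Sum>i\<in>I. \<Sum>c\<in>Basis. (1 - q (x i) * t) powr \<alpha> c * (l (i, c) + t * B i c)) = 0" by simp
  qed
  then show ?thesis by auto
qed

text \<open>Each factor \<open>\<phi> (- t) \<circ> (+ r One) \<circ> \<phi> t\<close> moves in the direction \<^term>\<open>Z t\<close> as \<open>r\<close> varies.\<close>

lemma composed_family:
  fixes L :: "real \<Rightarrow> 'e::real_normed_vector \<Rightarrow> real"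
  assumes "finite I" "finite F" and "\<And>t i. t \<in> F \<Longrightarrow> i \<in> I \<Longrightarrow> t * q (x i) < 1"
    and L: "\<And>t. t \<in> F \<Longrightarrow> bounded_linear (L t)"
  obtains H where "\<And>i. i \<in> I \<Longrightarrow> H 0 i = x i"
    "\<And>i. i \<in> I \<Longrightarrow> has_strict_derivative (\<lambda>\<tau>. H \<tau> i) (\<lambda>\<tau>. \<Sum>t\<in>F. L t \<tau> *\<^sub>R Z t (x i)) 0"
    "\<forall>\<^sub>F \<tau> in nhds 0. reach I x (H \<tau>)"
proof -
  have "\<exists>H. (\<forall>i\<in>I. H 0 i = x i \<and>
      has_strict_derivative (\<lambda>\<tau>. H \<tau> i) (\<lambda>\<tau>. \<Sum>t\<in>F. L t \<tau> *\<^sub>R Z t (x i)) 0) \<and>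
    (\<forall>\<^sub>F \<tau> in nhds 0. reach I x (H \<tau>))"
    using assms(2-4)
  proof (induction F rule: finite_induct)
    case empty
    show ?case by (intro exI[of _ "\<lambda>_. x"]) (auto simp: has_strict_derivative_const)
  next
    case (insert t F)
    then have "\<exists>H. (\<forall>i\<in>I. H 0 i = x i \<and>
        has_strict_derivative (\<lambda>\<tau>. H \<tau> i) (\<lambda>\<tau>. \<Sum>t\<in>F. L t \<tau> *\<^sub>R Z t (x i)) 0) \<and>
      (\<forall>\<^sub>F \<tau> in nhds 0. reach I x (H \<tau>))"
      by (intro insert.IH) auto
    then obtain H where H: "\<And>i. i \<in> I \<Longrightarrow> H 0 i = x i"
      "\<And>i. i \<in> I \<Longrightarrow> has_strict_derivative (\<lambda>\<tau>. H \<tau> i) (\<lambda>\<tau>. \<Sum>t\<in>F. L t \<tau> *\<^sub>R Z t (x i)) 0"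
      "\<forall>\<^sub>F \<tau> in nhds 0. reach I x (H \<tau>)"
      by blast
    have t: "t * q (x i) < 1" if "i \<in> I" for i using insert.prems(1) that by simp
    interpret L: bounded_linear "L t" using insert.prems(2) by simp
    define K where "K \<tau> i = \<phi> t (H \<tau> i) + L t \<tau> *\<^sub>R One" for \<tau> i
    have K0: "K 0 i = \<phi> t (x i)" if "i \<in> I" for i using H(1)[OF that] by (simp add: K_def L.zero)
    have LOne: "bounded_linear (\<lambda>\<tau>. L t \<tau> *\<^sub>R (One :: 'a))"
      by (rule bounded_linear_compose[OF bounded_linear_scaleR_left L.bounded_linear_axioms])
    have K: "has_strict_derivative (\<lambda>\<tau>. K \<tau> i)
        (\<lambda>\<tau>. D\<phi> t (x i) (\<Sum>t\<in>F. L t \<tau> *\<^sub>R Z t (x i)) + L t \<tau> *\<^sub>R One) 0" if "i \<in> I" for i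
      unfolding K_def
      by (intro has_strict_derivative_add has_strict_derivative_bounded_linear[OF LOne]
          has_strict_derivative_compose[OF H(2)[OF that], of "\<phi> t", unfolded H(1)[OF that]]
          \<phi>_has_strict_derivative t that)
    define H' where "H' \<tau> i = \<phi> (- t) (K \<tau> i)" for \<tau> i
    have "H' 0 i = x i" if "i \<in> I" for i using t that by (simp add: H'_def K0 \<phi>_inverse)
    moreover have "has_strict_derivative (\<lambda>\<tau>. H' \<tau> i) (\<lambda>\<tau>. \<Sum>t\<in>insert t F. L t \<tau> *\<^sub>R Z t (x i)) 0"
      if "i \<in> I" for i
    proof -
      note dom = \<phi>_domain_inverse[OF t[OF that]]
      interpret D: bounded_linear "D\<phi> (- t) (\<phi> t (x i))"
        using \<phi>_has_strict_derivative[OF dom] by (simp add: has_strict_derivative_def)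
      \<comment> \<open>\<open>D\<phi>_inverse\<close> returns the directions accumulated so far
        unchanged, and the translation contributes just the new summand along
        \<open>Z t (x i)\<close>.\<close>
      have "has_strict_derivative (\<lambda>\<tau>. H' \<tau> i) (\<lambda>\<tau>. D\<phi> (- t) (\<phi> t (x i))
          (D\<phi> t (x i) (\<Sum>t\<in>F. L t \<tau> *\<^sub>R Z t (x i)) + L t \<tau> *\<^sub>R One)) 0"
        unfolding H'_def
        by (rule has_strict_derivative_compose[OF K[OF that], of "\<phi> (- t)", unfolded K0[OF that]])
           (rule \<phi>_has_strict_derivative[OF dom])
      then show ?thesis using insert.hyps D\<phi>_inverse[OF t[OF that]]
        by (simp add: D.add D.scale Z_def add.commute)
    qed
    moreover have "\<forall>\<^sub>F \<tau> in nhds 0. reach I x (H' \<tau>)"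
    proof -
      \<comment> \<open>Both flow legs are only partially defined. Their domains are open and
        contain the points for parameter 0, so small parameters are admissible.\<close>
      have near: "\<forall>\<^sub>F \<tau> in nhds 0. \<forall>i\<in>I. r * q (f \<tau> i) < 1"
        if "\<And>i. i \<in> I \<Longrightarrow> isCont (\<lambda>\<tau>. f \<tau> i) 0" "\<And>i. i \<in> I \<Longrightarrow> r * q (f 0 i) < 1"
        for f :: "'e \<Rightarrow> nat \<Rightarrow> 'a" and r
      proof (intro eventually_ball_finite \<open>finite I\<close> ballI)
        fix i assume "i \<in> I"
        then have "((\<lambda>\<tau>. f \<tau> i) \<longlongrightarrow> f 0 i) (nhds 0)"
          using that(1) tendsto_at_iff_tendsto_nhds[of "\<lambda>\<tau>. f \<tau> i" 0] by (simp add: isCont_def)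
        from topological_tendstoD[OF this open_flow_domain[of r]]
        show "\<forall>\<^sub>F \<tau> in nhds 0. r * q (f \<tau> i) < 1" using that(2)[OF \<open>i \<in> I\<close>] by simp
      qed
      have "\<forall>\<^sub>F \<tau> in nhds 0. \<forall>i\<in>I. t * q (H \<tau> i) < 1"
        by (rule near) (use H t in \<open>auto intro: has_strict_derivative_isCont\<close>)
      moreover have "\<forall>\<^sub>F \<tau> in nhds 0. \<forall>i\<in>I. - t * q (K \<tau> i) < 1"
        by (rule near) (use K K0 t \<phi>_domain_inverse in \<open>auto intro: has_strict_derivative_isCont\<close>)
      ultimately show ?thesis using H(3)
      proof eventually_elim
        case (elim \<tau>)
        have "step I (H \<tau>) (\<lambda>i. \<phi> t (H \<tau> i))" using elim(1) by (intro step_\<phi>) auto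
        moreover have "step I (\<lambda>i. \<phi> t (H \<tau> i)) (K \<tau>)" by (rule step_translate) (simp add: K_def)
        moreover have "step I (K \<tau>) (H' \<tau>)" using elim(2) by (intro step_\<phi>[where t = "- t"]) (auto simp: H'_def)
        ultimately show ?case using elim(3) by (meson rtranclp.rtrancl_into_rtrancl)
      qed
    qed
    ultimately show ?case by blast
  qed
  then show thesis using that by blast
qed

end

text \<open>Bounded functions on \<open>nat\<close> serve both as parameters and as tuples of
  arbitrary length. Copying \<open>\<tau>\<close> outside \<open>I\<close> makes the parametrized
  family a self-map whose derivative can be the identity.\<close>

definition override_bcontfun :: "nat set \<Rightarrow> (nat \<Rightarrow> 'a::real_normed_vector) \<Rightarrow> (nat \<Rightarrow>\<^sub>C 'a) \<Rightarrow> (nat \<Rightarrow>\<^sub>C 'a)" where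
  "override_bcontfun I h \<tau> = Bcontfun (\<lambda>i. if i \<in> I then h i else apply_bcontfun \<tau> i)"

lemma complete_UNIV_bcontfun: "complete (UNIV :: ('a::topological_space \<Rightarrow>\<^sub>C 'b::complete_space) set)"
proof (rule completeI)
  fix f :: "nat \<Rightarrow> 'a \<Rightarrow>\<^sub>C 'b" assume "Cauchy f"
  then obtain g where "uniform_limit UNIV f g sequentially"
    using uniformly_convergent_eq_cauchy[of "\<lambda>_. True" f]
    unfolding Cauchy_def uniform_limit_sequentially_iff
    by (metis dist_fun_lt_imp_dist_val_lt)
  from uniform_limit_bcontfunE[OF this sequentially_bot]
  show "\<exists>l\<in>UNIV. f \<longlonglongrightarrow> l" by (metis UNIV_I)
qed

text \<open>Continuity is automatic on the discrete space \<open>nat\<close>, and altering finitely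
  many entries preserves boundedness.\<close>

lemma apply_override_bcontfun:
  assumes "finite I"
  shows "apply_bcontfun (override_bcontfun I h \<tau>) i = (if i \<in> I then h i else apply_bcontfun \<tau> i)"
proof -
  have bound: "norm (if i \<in> I then h i else apply_bcontfun \<tau> i) \<le> norm \<tau> + (\<Sum>i\<in>I. norm (h i))" for i
    using assms norm_bounded[of \<tau> i] member_le_sum[of i I "\<lambda>i. norm (h i)"] sum_nonneg[of I "\<lambda>i. norm (h i)"]
    by (auto intro: add_increasing2 add_increasing)
  have "(\<lambda>i. if i \<in> I then h i else apply_bcontfun \<tau> i) \<in> bcontfun"
    by (rule bcontfun_normI[OF Topological_Spaces.continuous_on_discrete bound])
  then show ?thesis by (simp add: override_bcontfun_def Bcontfun_inverse)
qed

text \<open>The supremum norm reduces the estimate to single entries: finitely many are governed by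
  \<open>H\<close>, and for all others the error is exactly 0.\<close>

lemma has_strict_derivative_override_bcontfun:
  assumes "finite I"
    and H: "\<And>i. i \<in> I \<Longrightarrow> has_strict_derivative (\<lambda>\<tau>. H \<tau> i) (\<lambda>\<tau>. apply_bcontfun \<tau> i) \<tau>"
  shows "has_strict_derivative (\<lambda>\<tau>. override_bcontfun I (H \<tau>) \<tau>) (\<lambda>\<tau>. \<tau>) \<tau>"
  unfolding has_strict_derivative_def
proof (intro conjI allI impI)
  fix e :: real assume "e > 0"
  have "\<forall>i\<in>I. \<exists>d>0. \<forall>y\<in>ball \<tau> d. \<forall>z\<in>ball \<tau> d.
      norm (H y i - H z i - apply_bcontfun (y - z) i) \<le> e * norm (y - z)"
    using H \<open>e > 0\<close> unfolding has_strict_derivative_def by blast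
  then obtain d where d: "\<And>i. i \<in> I \<Longrightarrow> d i > 0"
    "\<And>i y z. i \<in> I \<Longrightarrow> y \<in> ball \<tau> (d i) \<Longrightarrow> z \<in> ball \<tau> (d i) \<Longrightarrow>
      norm (H y i - H z i - apply_bcontfun (y - z) i) \<le> e * norm (y - z)"
    by metis
  define d' where "d' = Min (insert 1 (d ` I))"
  have "d' > 0" using d(1) assms(1) by (auto simp: d'_def)
  moreover have "norm (override_bcontfun I (H y) y - override_bcontfun I (H z) z - (y - z)) \<le> e * norm (y - z)"
    if "y \<in> ball \<tau> d'" "z \<in> ball \<tau> d'" for y z
  proof (rule norm_bound)
    fix i
    show "norm (apply_bcontfun (override_bcontfun I (H y) y - override_bcontfun I (H z) z - (y - z)) i)
        \<le> e * norm (y - z)"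
    proof (cases "i \<in> I")
      case True
      then have "y \<in> ball \<tau> (d i)" "z \<in> ball \<tau> (d i)" using that assms(1) by (auto simp: d'_def)
      then show ?thesis using d(2)[OF True] True by (simp add: apply_override_bcontfun assms(1))
    next
      case False
      then show ?thesis using \<open>e > 0\<close> by (simp add: apply_override_bcontfun assms(1))
    qed
  qed
  ultimately show "\<exists>d>0. \<forall>y\<in>ball \<tau> d. \<forall>z\<in>ball \<tau> d.
      norm (override_bcontfun I (H y) y - override_bcontfun I (H z) z - (y - z)) \<le> e * norm (y - z)"
    by blast
qed (rule bounded_linear_ident)

lemma bounded_linear_apply_bcontfun:
  "bounded_linear (\<lambda>\<tau> :: 'i::topological_space \<Rightarrow>\<^sub>C 'b::real_normed_vector. apply_bcontfun \<tau> i)"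
  by (rule bounded_linear_intro[where K = 1]) (auto simp: norm_bounded)

context cubic_system begin

text \<open>The dual coefficients choose parameters so that the composed family has derivative
  \<open>\<tau> i\<close> at each point; \<open>local_surjectivity\<close> then shows that it covers
  a neighbourhood of the tuple.\<close>

lemma open_orbit_generic:
  assumes "finite I" and pos: "\<And>i. i \<in> I \<Longrightarrow> q (x i) > 0" and inj: "inj_on (\<lambda>i. q (x i)) I"
  shows "open_orbit I x"
proof -
  define K where "K = I \<times> (Basis :: 'a set)"
  have "finite K" using assms(1) by (simp add: K_def)
  have "\<exists>F c. finite F \<and> F \<subseteq> {t. \<forall>i\<in>I. t * q (x i) < 1} \<and>
    (\<forall>k\<in>K. \<forall>m\<in>K. (\<Sum>t\<in>F. c m t * (Z t (x (fst k)) \<bullet> snd k)) = of_bool (k = m))"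
  proof (rule dual_coefficients_if_no_annihilator[OF \<open>finite K\<close>])
    fix l assume "\<forall>t\<in>{t. \<forall>i\<in>I. t * q (x i) < 1}. (\<Sum>k\<in>K. l k * (Z t (x (fst k)) \<bullet> snd k)) = 0"
    then show "\<forall>k\<in>K. l k = 0" using Z_no_annihilator[OF assms, of l] unfolding K_def by simp
  qed
  then obtain F c where F: "finite F" "F \<subseteq> {t. \<forall>i\<in>I. t * q (x i) < 1}"
    and c: "\<forall>k\<in>K. \<forall>m\<in>K. (\<Sum>t\<in>F. c m t * (Z t (x (fst k)) \<bullet> snd k)) = of_bool (k = m)"
    by (elim exE conjE) (rule that)
  \<comment> \<open>The coordinates of \<open>\<tau>\<close> weighted by the dual coefficients, so
    that the combination of the \<open>Z t (x i)\<close> reproduces \<open>\<tau> i\<close>.\<close>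
  define L where "L t \<tau> = (\<Sum>m\<in>K. (apply_bcontfun \<tau> (fst m) \<bullet> snd m) * c m t)"
    for t and \<tau> :: "nat \<Rightarrow>\<^sub>C 'a"
  have L: "bounded_linear (L t)" for t unfolding L_def
    by (intro bounded_linear_sum bounded_linear_mult_const
        bounded_linear_compose[OF bounded_linear_inner_left bounded_linear_apply_bcontfun])
  have sum_L: "(\<Sum>t\<in>F. L t \<tau> *\<^sub>R Z t (x i)) = apply_bcontfun \<tau> i" if "i \<in> I" for \<tau> i
  proof (rule euclidean_eqI)
    fix b :: 'a assume "b \<in> Basis"
    with that have k: "(i, b) \<in> K" by (simp add: K_def)
    have "(\<Sum>t\<in>F. L t \<tau> *\<^sub>R Z t (x i)) \<bullet> b
      = (\<Sum>t\<in>F. \<Sum>m\<in>K. (apply_bcontfun \<tau> (fst m) \<bullet> snd m) * (c m t * (Z t (x i) \<bullet> b)))"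
      by (simp add: inner_sum_left L_def sum_distrib_right mult.assoc)
    also have "\<dots> = (\<Sum>m\<in>K. (apply_bcontfun \<tau> (fst m) \<bullet> snd m) * (\<Sum>t\<in>F. c m t * (Z t (x i) \<bullet> b)))"
      by (subst sum.swap) (simp add: sum_distrib_left)
    also have "\<dots> = (\<Sum>m\<in>K. (apply_bcontfun \<tau> (fst m) \<bullet> snd m) * of_bool ((i, b) = m))"
      using bspec[OF c k] by (intro sum.cong) auto
    also have "\<dots> = apply_bcontfun \<tau> i \<bullet> b"
      using k \<open>finite K\<close> by (simp add: of_bool_def if_distrib[of "\<lambda>z. _ * z"] sum.delta' cong: if_cong)
    finally show "(\<Sum>t\<in>F. L t \<tau> *\<^sub>R Z t (x i)) \<bullet> b = apply_bcontfun \<tau> i \<bullet> b" .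
  qed
  obtain H where H: "\<And>i. i \<in> I \<Longrightarrow> H 0 i = x i"
    "\<And>i. i \<in> I \<Longrightarrow> has_strict_derivative (\<lambda>\<tau>. H \<tau> i) (\<lambda>\<tau>. \<Sum>t\<in>F. L t \<tau> *\<^sub>R Z t (x i)) 0"
    "\<forall>\<^sub>F \<tau> in nhds 0. reach I x (H \<tau>)"
    using composed_family[OF assms(1) F(1), of x L] F(2) L by blast
  define G where "G \<tau> = override_bcontfun I (H \<tau>) \<tau>" for \<tau>
  have "has_strict_derivative G (\<lambda>\<tau>. \<tau>) 0"
    unfolding G_def using H(2) by (intro has_strict_derivative_override_bcontfun assms) (simp add: sum_L)
  moreover obtain r where "r > 0" and r: "\<And>\<tau>. dist \<tau> 0 < r \<Longrightarrow> reach I x (H \<tau>)"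
  proof -
    have "\<exists>r>0. \<forall>\<tau>. dist \<tau> 0 < r \<longrightarrow> reach I x (H \<tau>)"
      using H(3) by (simp only: eventually_nhds_metric)
    then show thesis using that by (elim exE conjE) simp
  qed
  ultimately obtain d where "d > 0" and d: "\<forall>y\<in>cball (G 0) d. \<exists>z\<in>ball 0 r. G z = y"
    using local_surjectivity[OF complete_UNIV_bcontfun, of G 0 r] by blast
  have "reach I x y" if y: "\<forall>i\<in>I. dist (y i) (x i) < d" for y
  proof -
    \<comment> \<open>Both functions are 0 outside \<open>I\<close>, so the distance sees only the
      given points.\<close>
    have "dist (G 0) (override_bcontfun I y 0) \<le> d"
    proof (rule dist_bound)
      show "dist (apply_bcontfun (G 0) i) (apply_bcontfun (override_bcontfun I y 0) i) \<le> d" for i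
        using y \<open>d > 0\<close> H(1) by (auto simp: G_def apply_override_bcontfun assms(1) dist_commute less_imp_le)
    qed
    then obtain z where z: "z \<in> ball 0 r" "G z = override_bcontfun I y 0" using bspec[OF d, of "override_bcontfun I y 0"] unfolding mem_cball by blast
    have "y i = H z i" if "i \<in> I" for i
      using arg_cong[OF z(2), of "\<lambda>g. apply_bcontfun g i"] that
      by (simp add: G_def apply_override_bcontfun assms(1))
    then have "step I (H z) y" by (intro step_eq_on)
    moreover have "reach I x (H z)" using r z(1) by (simp add: dist_commute)
    ultimately show ?thesis by (rule rtranclp.rtrancl_into_rtrancl[rotated])
  qed
  then show ?thesis unfolding open_orbit_def using \<open>d > 0\<close> by blast
qed

lemma open_orbit_inj:
  assumes "finite I" "inj_on x I"
  shows "open_orbit I x"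
  using reach_generic_position[OF assms] open_orbit_reach[OF assms(1)] open_orbit_generic[OF assms(1)]
  by metis

text \<open>Along the segment the relation \<open>reach I\<close> has open classes, since every
  intermediate tuple is injective; the unit interval is connected, so there is only one
  class.\<close>

lemma reach_segment:
  assumes "finite I" and inj: "\<And>s. s \<in> {0..1} \<Longrightarrow> inj_on (\<lambda>i. (1 - s) *\<^sub>R x i + s *\<^sub>R y i) I"
  shows "reach I x y"
proof -
  define \<gamma> where "\<gamma> s i = (1 - s) *\<^sub>R x i + s *\<^sub>R y i" for s i
  have "reach I (\<gamma> 0) (\<gamma> 1)"
  proof (rule connected_equivalence_relation[where S = "{0..1::real}"])
    fix a :: real assume "a \<in> {0..1}"
    then have "open_orbit I (\<gamma> a)" using open_orbit_inj[OF assms(1) inj[of a]] by (simp add: \<gamma>_def[abs_def])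
    then obtain \<epsilon> where "\<epsilon> > 0" and \<epsilon>: "\<And>z. (\<forall>i\<in>I. dist (z i) (\<gamma> a i) < \<epsilon>) \<Longrightarrow> reach I (\<gamma> a) z"
      unfolding open_orbit_def by blast
    \<comment> \<open>A positive bound for the speed of every point along the segment.\<close>
    define M where "M = 1 + (\<Sum>i\<in>I. norm (y i - x i))"
    have M: "M > 0" "\<And>i. i \<in> I \<Longrightarrow> norm (y i - x i) \<le> M"
      using assms(1) sum_nonneg[of I "\<lambda>i. norm (y i - x i)"] member_le_sum[of _ I "\<lambda>i. norm (y i - x i)"]
      by (auto simp: M_def add_increasing intro: add_pos_nonneg)
    have "reach I (\<gamma> a) (\<gamma> s)" if "dist a s < \<epsilon> / M" for s
    proof (rule \<epsilon>, intro ballI)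
      fix i assume "i \<in> I"
      have "\<gamma> s i - \<gamma> a i = (s - a) *\<^sub>R (y i - x i)" by (simp add: \<gamma>_def algebra_simps)
      then have "dist (\<gamma> s i) (\<gamma> a i) = dist a s * norm (y i - x i)"
        by (simp add: dist_norm norm_minus_commute dist_real_def abs_minus_commute)
      also have "\<dots> \<le> dist a s * M" using M(2)[OF \<open>i \<in> I\<close>] by (intro mult_left_mono) auto
      also have "\<dots> < \<epsilon>" using that M(1) by (simp add: field_simps)
      finally show "dist (\<gamma> s i) (\<gamma> a i) < \<epsilon>" .
    qed
    then show "\<exists>T. openin (top_of_set {0..1}) T \<and> a \<in> T \<and> (\<forall>s\<in>T. reach I (\<gamma> a) (\<gamma> s))"
      using \<open>a \<in> {0..1}\<close> \<open>\<epsilon> > 0\<close> M(1)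
      by (intro exI[of _ "{0..1} \<inter> ball a (\<epsilon> / M)"]) (auto simp: openin_open_Int)
  qed (auto intro: reach_sym)
  then show ?thesis by (simp add: \<gamma>_def[abs_def])
qed

end

section \<open>Smoothness, homogeneity and realization by flows\<close>

lemma C_k_Suc_if_has_derivative:
  assumes "\<And>x. (f has_derivative f' x) (at x)" "\<And>v. C_k k (\<lambda>x. f' x v)"
  shows "C_k (Suc k) f"
proof -
  have "frechet_derivative f (at x) = f' x" for x
    by (rule frechet_derivative_at[OF assms(1), symmetric])
  moreover have "f differentiable_on UNIV"
    using assms(1) by (auto simp: differentiable_on_def intro: differentiableI)
  ultimately show ?thesis using assms(2) by simp
qed

lemma C_k_SucE:
  assumes "C_k (Suc k) f"
  shows "\<exists>f'. (\<forall>x. (f has_derivative f' x) (at x)) \<and> (\<forall>v. C_k k (\<lambda>x. f' x v))"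
  using assms
  by (intro exI[of _ "\<lambda>x. frechet_derivative f (at x)"])
     (simp add: differentiable_on_def flip: frechet_derivative_works)

lemma C_k_const: "C_k k (\<lambda>_. c)"
proof (induction k arbitrary: c)
  case (Suc k)
  show ?case by (rule C_k_Suc_if_has_derivative[OF has_derivative_const Suc.IH])
qed simp

lemma C_k_bounded_linear: "bounded_linear f \<Longrightarrow> C_k k f"
proof (cases k)
  case 0
  then show "bounded_linear f \<Longrightarrow> C_k k f" by (simp add: linear_continuous_on)
next
  case (Suc n)
  then show "bounded_linear f \<Longrightarrow> C_k k f"
    using C_k_Suc_if_has_derivative[of f "\<lambda>_. f" n]
    by (simp add: bounded_linear_imp_has_derivative C_k_const del: C_k.simps(2))
qed

text \<open>The product rule needs this: the derivative of a product still contains the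
  undifferentiated factors.\<close>

lemma C_k_Suc_imp_C_k: "C_k (Suc k) f \<Longrightarrow> C_k k f"
proof (induction k arbitrary: f)
  case 0
  then show ?case by (simp add: differentiable_imp_continuous_on)
next
  case (Suc k)
  obtain f' where "\<forall>x. (f has_derivative f' x) (at x)" "\<forall>v. C_k (Suc k) (\<lambda>x. f' x v)"
    using C_k_SucE[OF Suc.prems] by blast
  note f' = this[rule_format]
  show ?case by (rule C_k_Suc_if_has_derivative[OF f'(1) Suc.IH[OF f'(2)]])
qed

lemma C_k_add: "C_k k f \<Longrightarrow> C_k k g \<Longrightarrow> C_k k (\<lambda>x. f x + g x)"
proof (induction k arbitrary: f g)
  case 0
  then show ?case by (simp add: continuous_on_add)
next
  case (Suc k)
  obtain f' where "\<forall>x. (f has_derivative f' x) (at x)" "\<forall>v. C_k k (\<lambda>x. f' x v)"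
    using C_k_SucE[OF Suc.prems(1)] by blast
  note f' = this[rule_format]
  obtain g' where "\<forall>x. (g has_derivative g' x) (at x)" "\<forall>v. C_k k (\<lambda>x. g' x v)"
    using C_k_SucE[OF Suc.prems(2)] by blast
  note g' = this[rule_format]
  show ?case
  proof (rule C_k_Suc_if_has_derivative[where f' = "\<lambda>x v. f' x v + g' x v"])
    show "((\<lambda>x. f x + g x) has_derivative (\<lambda>v. f' x v + g' x v)) (at x)" for x
      by (rule has_derivative_add[OF f'(1) g'(1)])
    show "C_k k (\<lambda>x. f' x v + g' x v)" for v
      by (rule Suc.IH[OF f'(2) g'(2)])
  qed
qed

lemma C_k_scaleR: "C_k k f \<Longrightarrow> C_k k g \<Longrightarrow> C_k k (\<lambda>x. f x *\<^sub>R g x)"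
proof (induction k arbitrary: f g)
  case 0
  then show ?case by (simp add: continuous_on_scaleR)
next
  case (Suc k)
  obtain f' where "\<forall>x. (f has_derivative f' x) (at x)" "\<forall>v. C_k k (\<lambda>x. f' x v)"
    using C_k_SucE[OF Suc.prems(1)] by blast
  note f' = this[rule_format]
  obtain g' where "\<forall>x. (g has_derivative g' x) (at x)" "\<forall>v. C_k k (\<lambda>x. g' x v)"
    using C_k_SucE[OF Suc.prems(2)] by blast
  note g' = this[rule_format]
  note f = C_k_Suc_imp_C_k[OF Suc.prems(1)] and g = C_k_Suc_imp_C_k[OF Suc.prems(2)]
  show ?case
  proof (rule C_k_Suc_if_has_derivative[where f' = "\<lambda>x v. f x *\<^sub>R g' x v + f' x v *\<^sub>R g x"])
    show "((\<lambda>x. f x *\<^sub>R g x) has_derivative (\<lambda>v. f x *\<^sub>R g' x v + f' x v *\<^sub>R g x)) (at x)" for x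
      by (rule has_derivative_scaleR[OF f'(1) g'(1)])
    show "C_k k (\<lambda>x. f x *\<^sub>R g' x v + f' x v *\<^sub>R g x)" for v
      by (rule C_k_add[OF Suc.IH[OF f g'(2)] Suc.IH[OF f'(2) g]])
  qed
qed

lemma C_k_sum: "(\<And>a. a \<in> A \<Longrightarrow> C_k k (f a)) \<Longrightarrow> C_k k (\<lambda>x. \<Sum>a\<in>A. f a x)"
  by (induction A rule: infinite_finite_induct) (auto intro: C_k_const C_k_add)

lemma smooth_const: "smooth (\<lambda>_. c)"
  by (simp add: smooth_def C_k_const)

text \<open>The scalar condition on one component of \<open>homogeneous_polynomial_field\<close>,
  isolated so that components can be built by sums and multiples.\<close>

definition is_homogeneous_polynomial :: "nat \<Rightarrow> ('a::euclidean_space \<Rightarrow> real) \<Rightarrow> bool" where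
  "is_homogeneous_polynomial k f \<longleftrightarrow> (\<exists>c :: ('a \<Rightarrow> nat) \<Rightarrow> real. \<forall>x.
     f x = (\<Sum>\<mu> | \<mu> \<in> Basis \<rightarrow>\<^sub>E {..k} \<and> sum \<mu> Basis = k. c \<mu> * (\<Prod>e\<in>Basis. (x \<bullet> e) ^ \<mu> e)))"

lemma is_homogeneous_polynomial_cmult:
  assumes "is_homogeneous_polynomial k f"
  shows "is_homogeneous_polynomial k (\<lambda>x. r * f x)"
proof -
  obtain c where "\<And>x. f x = (\<Sum>\<mu> | \<mu> \<in> Basis \<rightarrow>\<^sub>E {..k} \<and> sum \<mu> Basis = k. c \<mu> * (\<Prod>e\<in>Basis. (x \<bullet> e) ^ \<mu> e))"
    using assms unfolding is_homogeneous_polynomial_def by blast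
  then show ?thesis unfolding is_homogeneous_polynomial_def
    by (intro exI[of _ "\<lambda>\<mu>. r * c \<mu>"]) (simp add: sum_distrib_left mult.assoc)
qed

lemma is_homogeneous_polynomial_sum:
  assumes "\<And>a. a \<in> A \<Longrightarrow> is_homogeneous_polynomial k (f a)"
  shows "is_homogeneous_polynomial k (\<lambda>x. \<Sum>a\<in>A. f a x)"
proof -
  have "\<forall>a\<in>A. \<exists>c. \<forall>x. f a x =
      (\<Sum>\<mu> | \<mu> \<in> Basis \<rightarrow>\<^sub>E {..k} \<and> sum \<mu> Basis = k. c \<mu> * (\<Prod>e\<in>Basis. (x \<bullet> e) ^ \<mu> e))"
    using assms unfolding is_homogeneous_polynomial_def by blast
  from bchoice[OF this] obtain c where c: "\<forall>a\<in>A. \<forall>x. f a x =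
      (\<Sum>\<mu> | \<mu> \<in> Basis \<rightarrow>\<^sub>E {..k} \<and> sum \<mu> Basis = k. c a \<mu> * (\<Prod>e\<in>Basis. (x \<bullet> e) ^ \<mu> e))"
    by blast
  have "(\<Sum>a\<in>A. f a x) =
      (\<Sum>\<mu> | \<mu> \<in> Basis \<rightarrow>\<^sub>E {..k} \<and> sum \<mu> Basis = k. (\<Sum>a\<in>A. c a \<mu>) * (\<Prod>e\<in>Basis. (x \<bullet> e) ^ \<mu> e))" for x
  proof -
    have "(\<Sum>a\<in>A. f a x) = (\<Sum>a\<in>A. \<Sum>\<mu> | \<mu> \<in> Basis \<rightarrow>\<^sub>E {..k} \<and> sum \<mu> Basis = k.
        c a \<mu> * (\<Prod>e\<in>Basis. (x \<bullet> e) ^ \<mu> e))"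
      using c by (intro sum.cong refl) blast
    also have "\<dots> = (\<Sum>\<mu> | \<mu> \<in> Basis \<rightarrow>\<^sub>E {..k} \<and> sum \<mu> Basis = k. \<Sum>a\<in>A.
        c a \<mu> * (\<Prod>e\<in>Basis. (x \<bullet> e) ^ \<mu> e))"
      by (rule sum.swap)
    finally show ?thesis by (simp only: sum_distrib_right)
  qed
  then show ?thesis unfolding is_homogeneous_polynomial_def by (intro exI allI)
qed

lemma is_homogeneous_polynomial_monomial:
  fixes b1 b2 b3 :: "'a::euclidean_space"
  assumes b: "b1 \<in> Basis" "b2 \<in> Basis" "b3 \<in> Basis"
  shows "is_homogeneous_polynomial 3 (\<lambda>x. (x \<bullet> b1) * (x \<bullet> b2) * (x \<bullet> b3))"
proof -
  \<comment> \<open>The multi-index counts how often each basis vector occurs among the three, which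
    may coincide; \<open>restrict\<close> provides the default value outside \<open>Basis\<close>
    that the extensional function space demands.\<close>
  define m :: "'a \<Rightarrow> nat" where
    "m = restrict (\<lambda>e. of_bool (e = b1) + of_bool (e = b2) + of_bool (e = b3)) Basis"
  define M where "M = {\<mu>. \<mu> \<in> (Basis :: 'a set) \<rightarrow>\<^sub>E {..3::nat} \<and> sum \<mu> Basis = 3}"
  have sum1: "(\<Sum>e\<in>Basis. of_bool (e = b) :: nat) = 1" if "b \<in> Basis" for b :: 'a
    using that by (simp add: of_bool_def)
  have "sum m Basis = 3" using b by (simp add: m_def sum.distrib sum1)
  then have "m \<in> M" by (auto simp: M_def m_def intro!: PiE_I)
  have prod1: "(\<Prod>e\<in>Basis. (x \<bullet> e) ^ of_bool (e = b)) = x \<bullet> b" if "b \<in> Basis" for b x :: 'a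
  proof -
    have "(\<Prod>e\<in>Basis. (x \<bullet> e) ^ of_bool (e = b)) = (\<Prod>e\<in>Basis. if e = b then x \<bullet> e else 1)"
      by (intro prod.cong) auto
    then show ?thesis using that by simp
  qed
  have "(\<Prod>e\<in>Basis. (x \<bullet> e) ^ m e) = (x \<bullet> b1) * (x \<bullet> b2) * (x \<bullet> b3)" for x
  proof -
    have "(\<Prod>e\<in>Basis. (x \<bullet> e) ^ m e) = (\<Prod>e\<in>Basis. (x \<bullet> e) ^ of_bool (e = b1) *
        (x \<bullet> e) ^ of_bool (e = b2) * (x \<bullet> e) ^ of_bool (e = b3))"
      by (intro prod.cong) (simp_all add: m_def power_add)
    then show ?thesis using b by (simp only: prod.distrib prod1)
  qed
  moreover have "finite M" unfolding M_def
    by (rule finite_subset[OF _ finite_PiE[of "Basis :: 'a set" "\<lambda>_. {..3}"]]) auto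
  ultimately have "(x \<bullet> b1) * (x \<bullet> b2) * (x \<bullet> b3)
      = (\<Sum>\<mu>\<in>M. of_bool (\<mu> = m) * (\<Prod>e\<in>Basis. (x \<bullet> e) ^ \<mu> e))" for x
    using \<open>m \<in> M\<close> by (simp add: of_bool_def if_distrib[of "\<lambda>z. z * _"] cong: if_cong)
  then show ?thesis unfolding is_homogeneous_polynomial_def M_def by (intro exI allI)
qed

section \<open>Realization of moves by compositions of local flows\<close>

lemma flow_composition_ConsI:
  assumes "flow_composition X Y sts x = Some y" "flow Y t y = Some z" "flow X s z = Some w"
  shows "flow_composition X Y ((s, t) # sts) x = Some w"
  using assms by (simp add: flow_composition_def map_comp_def)

lemma flow_const:
  fixes v :: "'a::euclidean_space"
  shows "flow (\<lambda>_. v) s x = Some (x + s *\<^sub>R v)"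
proof -
  have "((\<lambda>r. x + r *\<^sub>R v) has_vector_derivative v) (at r)" for r
    by (rule has_vector_derivative_eq_rhs[OF has_vector_derivative_add[OF has_vector_derivative_const
          has_vector_derivative_scaleR[OF DERIV_ident has_vector_derivative_const]]]) simp
  then have "flows_to (\<lambda>_. v) s x (x + s *\<^sub>R v)"
    unfolding flows_to_def by (intro exI[of _ UNIV] exI[of _ "\<lambda>r. x + r *\<^sub>R v"]) simp
  then show ?thesis by (simp only: flow_eq_Some_iff[OF smooth_const])
qed

context cubic_system begin

lemma smooth_Y: "smooth Y"
proof -
  have inner: "C_k k (\<lambda>x. x \<bullet> b)" for k and b :: 'a
    by (rule C_k_bounded_linear[OF bounded_linear_inner_left])
  have mult: "C_k k (\<lambda>x. f x * g x)" if "C_k k f" "C_k k g" for k and f g :: "'a \<Rightarrow> real"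
    using C_k_scaleR[OF that] by simp
  have "C_k k q" for k unfolding q_def[abs_def] by (rule C_k_sum, rule mult[OF inner inner])
  then have "C_k k (\<lambda>x. (q x * \<alpha> b * (x \<bullet> b)) *\<^sub>R b)" for k b
    by (rule C_k_scaleR[OF mult[OF mult[OF _ C_k_const] inner] C_k_const])
  then show ?thesis unfolding smooth_def Y_def[abs_def] by (intro allI C_k_sum)
qed

lemma homogeneous_Y: "homogeneous_polynomial_field 3 Y"
proof -
  have "is_homogeneous_polynomial 3 (\<lambda>x. Y x \<bullet> b)" if b: "b \<in> Basis" for b
  proof -
    have "Y x \<bullet> b = (\<Sum>c\<in>Basis. \<alpha> b * ((x \<bullet> b) * (x \<bullet> c) * (x \<bullet> \<iota> c)))" for x
      using b by (simp add: Y_def q_def sum_distrib_left sum_distrib_right mult_ac)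
    then show ?thesis
      using b by (simp only:) (intro is_homogeneous_polynomial_sum is_homogeneous_polynomial_cmult
          is_homogeneous_polynomial_monomial \<iota>_Basis)
  qed
  then show ?thesis unfolding homogeneous_polynomial_field_def is_homogeneous_polynomial_def by blast
qed

text \<open>All admissible times form an open interval around 0 on which \<open>\<phi>\<close> is an
  integral curve; smoothness of \<open>Y\<close> makes the endpoint unique.\<close>

lemma flow_Y:
  assumes "t * q x < 1"
  shows "flow Y t x = Some (\<phi> t x)"
proof -
  let ?I = "{t. t * q x < 1}"
  have "open ?I" by (intro open_Collect_less continuous_intros)
  moreover have "is_interval ?I" unfolding is_interval_convex_1
    using convex_halfspace_lt[of "q x" 1] by (simp add: mult.commute)
  moreover have "\<forall>s\<in>?I. ((\<lambda>s. \<phi> s x) has_vector_derivative Y (\<phi> s x)) (at s)"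
    by (simp add: \<phi>_has_vector_derivative)
  ultimately have "flows_to Y t x (\<phi> t x)"
    unfolding flows_to_def using assms by (intro exI[of _ ?I] exI[of _ "\<lambda>s. \<phi> s x"]) simp
  then show ?thesis by (simp only: flow_eq_Some_iff[OF smooth_Y])
qed

text \<open>A move uses only one of the two fields, so the other one gets time 0. The head of the
  list acts last, hence a new move is put in front.\<close>

lemma reach_imp_flow_composition:
  assumes "reach I x y"
  shows "\<exists>sts. \<forall>i\<in>I. flow_composition (\<lambda>_. One) Y sts (x i) = Some (y i)"
  using assms
proof (induction rule: rtranclp_induct)
  case base
  show ?case by (intro exI[of _ "[]"]) (simp add: flow_composition_def)
next
  case (step y z)
  from step.IH obtain sts where sts: "\<And>i. i \<in> I \<Longrightarrow> flow_composition (\<lambda>_. One) Y sts (x i) = Some (y i)"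
    by blast
  from step.hyps(2) show ?case unfolding step_def
  proof (elim disjE exE)
    fix s assume "\<forall>i\<in>I. z i = y i + s *\<^sub>R One"
    then have "flow_composition (\<lambda>_. One) Y ((s, 0) # sts) (x i) = Some (z i)" if "i \<in> I" for i
      using that flow_Y[of 0 "y i"] by (intro flow_composition_ConsI[OF sts]) (auto simp: flow_const)
    then show ?thesis by blast
  next
    fix t assume "\<forall>i\<in>I. t * q (y i) < 1 \<and> z i = \<phi> t (y i)"
    then have "flow_composition (\<lambda>_. One) Y ((0, t) # sts) (x i) = Some (z i)" if "i \<in> I" for i
      using that flow_Y[of t "y i"] by (intro flow_composition_ConsI[OF sts]) (auto simp: flow_const)
    then show ?thesis by blast
  qed
qed

end

section \<open>Connecting tuples by segments\<close>

text \<open>Number the basis from 0 to d - 1, take the equally spaced values 1/(d+1), ..., d/(d+1)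
  for \<open>\<alpha>\<close>, and let \<open>\<iota>\<close> reverse the numbering. For d = 1 this
  gives \<open>\<alpha>\<close> the value 1/2 and \<open>\<iota>\<close> the identity.\<close>

lemma ex_cubic_system:
  "\<exists>\<alpha> \<iota>. cubic_system (\<alpha> :: 'a::euclidean_space \<Rightarrow> real) \<iota>"
proof -
  obtain h where h: "bij_betw h (Basis :: 'a set) {0..<DIM('a)}"
    using ex_bij_betw_finite_nat[OF finite_Basis] by blast
  define g where "g = the_inv_into (Basis :: 'a set) h"
  have lt: "h b < DIM('a)" if "b \<in> Basis" for b using h that by (auto simp: bij_betw_def)
  have g: "g m \<in> Basis" "h (g m) = m" if "m < DIM('a)" for m
    using h that by (auto simp: g_def bij_betw_def intro!: the_inv_into_into f_the_inv_into_f)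
  have gh: "g (h b) = b" if "b \<in> Basis" for b
    using h that by (simp add: g_def bij_betw_def the_inv_into_f_f)
  define \<alpha> where "\<alpha> b = (real (h b) + 1) / (real DIM('a) + 1)" for b
  define \<iota> where "\<iota> b = g (DIM('a) - 1 - h b)" for b
  have h\<iota>: "h (\<iota> b) = DIM('a) - 1 - h b" if "b \<in> Basis" for b
    unfolding \<iota>_def by (rule g(2)) (use DIM_positive[where 'a = 'a] in linarith)
  have "cubic_system \<alpha> \<iota>"
  proof
    show "inj_on \<alpha> Basis"
      using h by (auto simp: inj_on_def \<alpha>_def bij_betw_def add_pos_nonneg divide_eq_eq)
    fix b :: 'a assume b: "b \<in> Basis"
    show "0 < \<alpha> b" by (simp add: \<alpha>_def add_nonneg_pos)
    show "\<iota> b \<in> Basis"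
      unfolding \<iota>_def by (rule g(1)) (use DIM_positive[where 'a = 'a] in linarith)
    show "\<iota> (\<iota> b) = b" using h\<iota>[OF b] lt[OF b] gh[OF b] by (simp add: \<iota>_def)
    have "real (h b) + real (h (\<iota> b)) = real DIM('a) - 1"
      using h\<iota>[OF b] lt[OF b] by linarith
    then have "(real (h b) + 1) + (real (h (\<iota> b)) + 1) = real DIM('a) + 1" by simp
    then show "\<alpha> b + \<alpha> (\<iota> b) = 1"
      by (simp only: \<alpha>_def add_divide_distrib[symmetric]) simp
  qed
  then show ?thesis by blast
qed

text \<open>The vectors \<open>b + m b'\<close> lie on pairwise different lines through the origin,
  so finitely many lines cannot contain them all.\<close>

lemma ex_vector_off_lines:
  fixes V :: "'a::euclidean_space set"
  assumes "DIM('a) > 1" "finite V"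
  shows "\<exists>u. \<forall>v\<in>V. \<forall>c. u \<noteq> c *\<^sub>R v"
proof (rule ccontr)
  obtain b b' :: 'a where b: "b \<in> Basis" "b' \<in> Basis" "b \<noteq> b'"
    using assms(1) card_le_Suc0_iff_eq[OF finite_Basis] by (metis One_nat_def not_less)
  define u where "u m = b + real m *\<^sub>R b'" for m
  assume "\<not> ?thesis"
  then have "\<forall>m. \<exists>v. v \<in> V \<and> (\<exists>c. u m = c *\<^sub>R v)" by blast
  then obtain f where f: "\<And>m. f m \<in> V" "\<And>m. \<exists>c. u m = c *\<^sub>R f m" by metis
  have "inj f"
  proof (rule injI)
    fix m m' assume eq: "f m = f m'"
    obtain c c' where c: "u m = c *\<^sub>R f m" "u m' = c' *\<^sub>R f m" using f(2)[of m] f(2)[of m'] eq by auto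
    \<comment> \<open>The coordinate 1 along \<open>b\<close> fixes the scalar, and the coordinate
      along \<open>b'\<close> then recovers \<open>m\<close>.\<close>
    have "u m \<bullet> b = 1" "u m' \<bullet> b = 1" using b by (simp_all add: u_def inner_add_left inner_Basis)
    with c have "c * (f m \<bullet> b) = 1" "c' * (f m \<bullet> b) = 1" by simp_all
    then have "c = c'" by (metis mult_cancel_right mult_zero_right zero_neq_one)
    then have "u m = u m'" using c by simp
    then have "u m \<bullet> b' = u m' \<bullet> b'" by simp
    then show "m = m'" using b by (simp add: u_def inner_add_left inner_Basis)
  qed
  then have "infinite (range f)" using finite_imageD infinite_UNIV_nat by blast
  then show False using f(1) assms(2) by (meson finite_subset image_subsetI)
qed

text \<open>A collision at a parameter \<open>s > 0\<close> would express \<open>u\<close> as a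
  multiple of some \<open>x i - x k\<close>; at \<open>s = 0\<close> the tuple is \<open>x\<close>
  itself.\<close>

lemma segment_to_line_inj:
  fixes x :: "nat \<Rightarrow> 'a::real_vector"
  assumes "inj_on x I" and u: "\<And>i k c. i \<in> I \<Longrightarrow> k \<in> I \<Longrightarrow> i \<noteq> k \<Longrightarrow> u \<noteq> c *\<^sub>R (x i - x k)"
    and s: "s \<in> {0..1::real}"
  shows "inj_on (\<lambda>i. (1 - s) *\<^sub>R x i + s *\<^sub>R (real i *\<^sub>R u)) I"
proof (rule inj_onI, rule ccontr)
  fix i k assume ik: "i \<in> I" "k \<in> I" "i \<noteq> k"
    and eq: "(1 - s) *\<^sub>R x i + s *\<^sub>R (real i *\<^sub>R u) = (1 - s) *\<^sub>R x k + s *\<^sub>R (real k *\<^sub>R u)"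
  have eq': "(s * (real k - real i)) *\<^sub>R u = (1 - s) *\<^sub>R (x i - x k)"
    using eq by (simp add: algebra_simps)
  show False
  proof (cases "s = 0")
    case True
    then show False using eq ik assms(1) by (simp add: inj_on_eq_iff)
  next
    case False
    define a where "a = s * (real k - real i)"
    have "a \<noteq> 0" using False ik by (simp add: a_def)
    then have "u = inverse a *\<^sub>R (a *\<^sub>R u)" by simp
    also have "\<dots> = (inverse a * (1 - s)) *\<^sub>R (x i - x k)"
      unfolding eq'[folded a_def] by simp
    finally show False using u[OF ik] by blast
  qed
qed

context cubic_system begin

text \<open>Both tuples are joined to the same collinear tuple of multiples of \<open>u\<close>,
  whose direction avoids all differences within \<open>x\<close> and within
  \<open>y\<close>.\<close>

lemma reach_multidim:
  assumes "DIM('a) > 1" "finite I" "inj_on x I" "inj_on y I"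
  shows "reach I x y"
proof -
  define V where "V = (\<lambda>(i, k). x i - x k) ` (I \<times> I) \<union> (\<lambda>(i, k). y i - y k) ` (I \<times> I)"
  have "finite V" using assms(2) by (simp add: V_def)
  then obtain u where u: "\<forall>v\<in>V. \<forall>c. u \<noteq> c *\<^sub>R v" using ex_vector_off_lines[OF assms(1)] by blast
  have "x i - x k \<in> V" "y i - y k \<in> V" if "i \<in> I" "k \<in> I" for i k
    using that by (auto simp: V_def)
  then have "reach I x (\<lambda>i. real i *\<^sub>R u)" "reach I y (\<lambda>i. real i *\<^sub>R u)"
    using u assms by (auto intro!: reach_segment segment_to_line_inj)
  then show ?thesis using reach_sym by (meson rtranclp_trans)
qed

end

text \<open>Convex combinations of equally ordered tuples keep the strict order. The endpoint
  \<open>s = 1\<close> is separate because strictness then comes from \<open>y\<close> instead of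
  \<open>x\<close>.\<close>

lemma segment_inj_if_same_order:
  fixes x y :: "nat \<Rightarrow> real"
  assumes "inj_on x I" and ord: "\<And>i k. i \<in> I \<Longrightarrow> k \<in> I \<Longrightarrow> x i < x k \<longleftrightarrow> y i < y k"
    and s: "s \<in> {0..1}"
  shows "inj_on (\<lambda>i. (1 - s) *\<^sub>R x i + s *\<^sub>R y i) I"
proof -
  have less: "(1 - s) * x i + s * y i < (1 - s) * x k + s * y k"
    if "i \<in> I" "k \<in> I" "x i < x k" for i k
  proof (cases "s = 1")
    case True
    then show ?thesis using ord that by simp
  next
    case False
    have "y i \<le> y k" using ord that by (simp add: less_imp_le)
    then show ?thesis using s False that by (intro add_less_le_mono mult_strict_left_mono mult_left_mono) auto
  qed
  show ?thesis
  proof (rule inj_onI, rule ccontr)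
    fix i k assume ik: "i \<in> I" "k \<in> I" "i \<noteq> k"
      and eq: "(1 - s) *\<^sub>R x i + s *\<^sub>R y i = (1 - s) *\<^sub>R x k + s *\<^sub>R y k"
    have "x i \<noteq> x k" using assms(1) ik by (simp add: inj_on_eq_iff)
    then show False using less[of i k] less[of k i] ik eq by (auto simp: neq_iff)
  qed
qed

theorem theorem1p1:
  shows
   "(1 < CARD('d::finite) \<longrightarrow>
      (\<exists>X Y :: real ^ 'd \<Rightarrow> real ^ 'd.
         smooth X \<and> smooth Y \<and> X constant_on UNIV \<and> homogeneous_polynomial_field 3 Y \<and>
         (\<forall>(n::nat) \<ge> 1. \<forall>x y :: nat \<Rightarrow> real ^ 'd.
            inj_on x {1..n} \<longrightarrow> inj_on y {1..n} \<longrightarrow>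
            (\<exists>sts :: (real \<times> real) list.
               \<forall>i\<in>{1..n}. flow_composition X Y sts (x i) = Some (y i)))))
    \<and>
    (\<exists>X Y :: real \<Rightarrow> real.
       smooth X \<and> smooth Y \<and> X constant_on UNIV \<and> homogeneous_polynomial_field 3 Y \<and>
       (\<forall>(n::nat) \<ge> 1. \<forall>x y :: nat \<Rightarrow> real.
          inj_on x {1..n} \<longrightarrow> inj_on y {1..n} \<longrightarrow>
          (\<forall>i\<in>{1..n}. \<forall>j\<in>{1..n}. x i < x j \<longleftrightarrow> y i < y j) \<longrightarrow>
          (\<exists>sts :: (real \<times> real) list.
             \<forall>i\<in>{1..n}. flow_composition X Y sts (x i) = Some (y i))))"
proof (intro conjI impI)
  assume d: "1 < CARD('d)"
  obtain \<alpha> \<iota> where "cubic_system (\<alpha> :: real ^ 'd \<Rightarrow> real) \<iota>" using ex_cubic_system by blast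
  then interpret cubic_system \<alpha> \<iota> .
  have "\<exists>sts. \<forall>i\<in>{1..n}. flow_composition (\<lambda>_. One) Y sts (x i) = Some (y i)"
    if "inj_on x {1..n}" "inj_on y {1..n}" for n :: nat and x y :: "nat \<Rightarrow> real ^ 'd"
    using d that by (intro reach_imp_flow_composition reach_multidim) auto
  then show "\<exists>X Y :: real ^ 'd \<Rightarrow> real ^ 'd.
      smooth X \<and> smooth Y \<and> X constant_on UNIV \<and> homogeneous_polynomial_field 3 Y \<and>
      (\<forall>(n::nat) \<ge> 1. \<forall>x y :: nat \<Rightarrow> real ^ 'd. inj_on x {1..n} \<longrightarrow> inj_on y {1..n} \<longrightarrow>
        (\<exists>sts. \<forall>i\<in>{1..n}. flow_composition X Y sts (x i) = Some (y i)))"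
    by (intro exI[of _ "\<lambda>_. One"] exI[of _ Y] conjI smooth_const smooth_Y homogeneous_Y)
       (auto simp: constant_on_def)
next
  obtain \<alpha> \<iota> where "cubic_system (\<alpha> :: real \<Rightarrow> real) \<iota>" using ex_cubic_system by blast
  then interpret cubic_system \<alpha> \<iota> .
  have "\<exists>sts. \<forall>i\<in>{1..n}. flow_composition (\<lambda>_. One) Y sts (x i) = Some (y i)"
    if "inj_on x {1..n}" "\<forall>i\<in>{1..n}. \<forall>j\<in>{1..n}. x i < x j \<longleftrightarrow> y i < y j"
    for n :: nat and x y :: "nat \<Rightarrow> real"
    using that
    by (intro reach_imp_flow_composition reach_segment segment_inj_if_same_order) auto
  then show "\<exists>X Y :: real \<Rightarrow> real.
      smooth X \<and> smooth Y \<and> X constant_on UNIV \<and> homogeneous_polynomial_field 3 Y \<and>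
      (\<forall>(n::nat) \<ge> 1. \<forall>x y :: nat \<Rightarrow> real. inj_on x {1..n} \<longrightarrow> inj_on y {1..n} \<longrightarrow>
        (\<forall>i\<in>{1..n}. \<forall>j\<in>{1..n}. x i < x j \<longleftrightarrow> y i < y j) \<longrightarrow>
        (\<exists>sts. \<forall>i\<in>{1..n}. flow_composition X Y sts (x i) = Some (y i)))"
    by (intro exI[of _ "\<lambda>_. One"] exI[of _ Y] conjI smooth_const smooth_Y homogeneous_Y)
       (auto simp: constant_on_def)
qed

end
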